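(* Let $m,n$ be positive integers and let $\psi:\mathbb{R}_+\to\mathbb{R}_+$ be a non-increasing continuous function. Let $\mathcal{W}_{m\times n}(\psi,k)$ be the set of $A\in I_{m\times n}$ for which there exist infinitely many $\mathbf{q}\in Z^n$ such that $$\|\mathbf{p}+A\mathbf{q}\|^m<\psi(\|\mathbf{q}\|^n)$$ for some $\mathbf{p}\in Z^m$. Then $$\lambda(\mathcal{W}_{m\times n}(\psi,k))=\begin{cases}0&\text{if }\sum_{x=1}^\infty\psi(x)\text{ converges},\\ 1&\text{if }\sum_{x=1}^\infty\psi(x)\text{ diverges}.\end{cases}$$
   Context: Let $\mathbb{F}_s$ be the finite field with $s$ elements ($s$ a prime power), $Z=\mathbb{F}_s[X]$, $k=\mathbb{F}_s((X^{-1}))$ with absolute value $|a|=s^{-v(a)}$, where for $a=\sum_i a_iX^{-i}$, $v(a)=\sup\{j\in\mathbb{Z}: a_i=0\ \forall i<j\}$. $\|\cdot\|$ is the sup norm on vectors and matrices over $k$. $I_{m\times n}=\{A\in\mathrm{M}_{m\times n}(k):\|A\|\le1\}$, and $\lambda$ is Haar ("Lebesgue") measure on the additive group $\mathrm{M}_{m\times n}(k)$ normalized so that $\lambda(I_{m\times n})=1$. *)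

theory Defs
  imports
    "HOL-Analysis.Analysis"
    "HOL-Computational_Algebra.Formal_Laurent_Series"
begin

text \<open>
  Throughout, the finite field with \<open>s\<close> elements is a type \<open>'a :: {field, finite}\<close> with
  \<open>s = CARD('a)\<close>, and \<open>k\<close> is the type \<open>'a fls\<close>, where the variable of the Laurent series stands
  for \<open>X\<^sup>-\<^sup>1\<close>: the coefficient of \<open>X\<^sup>-\<^sup>i\<close> in \<open>a\<close> is \<open>fls_nth a i\<close>, the element \<open>X\<close> is
  \<^const>\<open>fls_X_inv\<close>, and \<open>v(a)\<close> is \<open>fls_subdegree a\<close> for \<open>a \<noteq> 0\<close>. The library sets
  \<open>fls_subdegree 0 = 0\<close> instead of \<open>v(0) = \<infinity>\<close>, hence the case distinction.
\<close>

definition absval :: "'a::{field,finite} fls \<Rightarrow> real" where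
  "absval a = (if a = 0 then 0 else real CARD('a) powi (- fls_subdegree a))"

definition sup_norm :: "'a::{field,finite} fls ^ 'n \<Rightarrow> real" where
  "sup_norm x = Max (range (\<lambda>i. absval (x $ i)))"

definition mat_sup_norm :: "'a::{field,finite} fls ^ 'n ^ 'm \<Rightarrow> real" where
  "mat_sup_norm A = Max (range (\<lambda>(i, j). absval (A $ i $ j)))"

text \<open>The inclusion of \<open>Z = F\<^sub>s[X]\<close> in \<open>k\<close>: evaluation of a polynomial at \<open>X\<close>.\<close>

definition poly_to_k :: "'a::{field,finite} poly \<Rightarrow> 'a fls" where
  "poly_to_k p = poly (map_poly fls_const p) fls_X_inv"

definition vec_to_k :: "'a::{field,finite} poly ^ 'n \<Rightarrow> 'a fls ^ 'n" where
  "vec_to_k q = (\<chi> i. poly_to_k (q $ i))"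

definition unit_matrices :: "('a::{field,finite} fls ^ 'n ^ 'm) set" where
  "unit_matrices = {A. mat_sup_norm A \<le> 1}"

text \<open>
  Regularity is not listed below: on a locally compact second countable group such as \<open>k^(m n)\<close>,
  every Borel measure that is finite on compact sets is regular.
\<close>

definition haar_measure :: "'g::{ab_group_add,topological_space} measure \<Rightarrow> bool" where
  "haar_measure M \<longleftrightarrow>
     sets M = sets borel \<and>
     (\<forall>x. \<forall>E\<in>sets borel. emeasure M ((\<lambda>y. x + y) ` E) = emeasure M E) \<and>
     (\<forall>K. compact K \<longrightarrow> emeasure M K < \<infinity>) \<and>
     (\<forall>U. open U \<longrightarrow> U \<noteq> {} \<longrightarrow> emeasure M U > 0)"

definition W_set :: "(real \<Rightarrow> real) \<Rightarrow> ('a::{field,finite} fls ^ 'n ^ 'm) set" where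
  "W_set \<psi> =
     {A \<in> unit_matrices.
        infinite {q :: 'a poly ^ 'n.
          \<exists>p :: 'a poly ^ 'm.
            sup_norm (vec_to_k p + A *v vec_to_k q) ^ CARD('m)
              < \<psi> (sup_norm (vec_to_k q) ^ CARD('n))}}"

text \<open>
  The library metric on \<^typ>\<open>'a fls\<close> has base 2 instead of base \<open>s\<close>. It induces the topology
  given by \<^const>\<open>absval\<close>, so the Borel sets and compact sets above are the intended ones.
\<close>

lemma open_fls_absval:
  fixes S :: "'a::{field,finite} fls set"
  shows "open S \<longleftrightarrow> (\<forall>a\<in>S. \<exists>r>0. {y. absval (y - a) < r} \<subseteq> S)"
proof -
  have s: "real CARD('a) > 1"
  proof -
    have "card {0, 1::'a} \<le> CARD('a)" by (rule card_mono) auto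
    then show ?thesis by simp
  qed
  have small: "\<exists>N::nat. b powi (- int N) < r" if "b > 1" "r > 0" for b r :: real
  proof -
    have "inverse b < 1" using that by (simp add: inverse_less_1_iff)
    then obtain N where "inverse b ^ N < r"
      using real_arch_pow_inv \<open>r > 0\<close> by blast
    then show ?thesis using that
      by (intro exI[of _ N]) (simp add: power_int_minus power_inverse)
  qed
  have ltiff: "b powi (- i) < b powi (- j) \<longleftrightarrow> j < i" if "b > 1" for b :: real and i j :: int
    using that power_int_strict_increasing[of "- i" "- j" b] power_int_increasing[of "- j" "- i" b]
    by (metis less_le_not_le linorder_not_less neg_less_iff_less order_less_imp_le)
  have dist: "dist y a = (if y - a = 0 then 0 else 2 powi (- fls_subdegree (y - a)))"
    for y a :: "'a fls"
    by (auto simp: dist_fls_def power_int_def power_one_over inverse_eq_divide)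
  have ball: "dist y a < 2 powi (- int N) \<longleftrightarrow> absval (y - a) < real CARD('a) powi (- int N)"
    for y a :: "'a fls" and N
    using s by (auto simp: dist absval_def ltiff[of 2] ltiff[OF s] simp del: power_int_minus)
  show ?thesis
    unfolding open_fls_def
  proof (intro ball_cong refl iffI)
    fix a assume "\<exists>r>0. {y. dist y a < r} \<subseteq> S"
    then obtain r where r: "r > 0" "{y. dist y a < r} \<subseteq> S" by auto
    obtain N where "2 powi (- int N) < r" using small[of 2 r] r by auto
    then have "{y. absval (y - a) < real CARD('a) powi (- int N)} \<subseteq> S"
      using r by (auto simp flip: ball)
    then show "\<exists>r>0. {y. absval (y - a) < r} \<subseteq> S"
      using s by (intro exI[of _ "real CARD('a) powi (- int N)"]) auto
  next
    fix a assume "\<exists>r>0. {y. absval (y - a) < r} \<subseteq> S"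
    then obtain r where r: "r > 0" "{y. absval (y - a) < r} \<subseteq> S" by auto
    obtain N where "real CARD('a) powi (- int N) < r" using small[OF s] r by auto
    then have "{y. dist y a < 2 powi (- int N)} \<subseteq> S"
      using r by (auto simp: ball)
    then show "\<exists>r>0. {y. dist y a < r} \<subseteq> S"
      by (intro exI[of _ "2 powi (- int N)"]) auto
  qed
qed

end

theory Submission
  imports Defs "HOL-Probability.Probability_Measure"
begin

text \<open>
  Condensation turns the sum over \<open>\<psi>\<close> into the sum of \<open>s\<^sup>j\<^sup>n \<psi>(s\<^sup>j\<^sup>n)\<close> over the degrees \<open>j\<close>. For
  \<open>q \<noteq> 0\<close> the fractional part of \<open>A q\<close> is equidistributed, so the convergence case is the
  Borel--Cantelli lemma.

  For the divergence case only denominators \<open>q\<close> with a monic coordinate of top degree and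
  numerators coprime to it are used. If \<open>q\<close> and \<open>q'\<close> are linearly independent, the fractional
  parts of \<open>A q\<close> and \<open>A q'\<close> are independent. If they are parallel, coprimality
  makes \<open>D = q'p - qp'\<close> a non-zero multiple of the greatest common divisor of the leading coordinates,
  and counting the possible \<open>D\<close> bounds the intersection by a multiple of the product. The
  Chung--Erdos inequality then gives a lower bound for the measure of the approximable set that is
  uniform in \<open>\<psi>\<close> and in the Haar measure. Substituting \<open>q = X\<^sup>t q'\<close> transfers this bound to every
  small ball, and since the complement of the approximable set is a countable union of decreasing
  intersections of finite unions of small balls, it is a null set.
\<close>

subsection \<open>Balls in the field of Laurent series\<close>

text \<open>The obstacle is denominators on a common line: for n = 1 all of them are parallel, and a
  very good approximation (p, q) makes (hp, hq) a good one as well, so events without a coprimality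
  condition overlap too much. With coprime numerators the measure of an event contains the totient
  of the leading entry of q, which can be relatively small for a single q. A bound on average
  suffices: the norm of a polynomial vector depends on its degree alone, so all q of one degree
  share the same radius.

  Passing from a positive lower bound to full measure uses that a set of matrices avoiding
  approximation is a limit of sets depending on finitely many digits. The approximable set fills a
  fixed proportion c of each of these, and a measure x with x <= (1 - c) x vanishes. The same c must
  work at every scale t. There \<psi> becomes the function \<psi>(s^(tn) x) and \<mu> a normalised
  image of itself, which is why c depends on s and m only.\<close>

lemma card_gt_1: "real CARD('a::{field,finite}) > 1"
proof -
  have "card {0, 1::'a} \<le> CARD('a)" by (rule card_mono) auto
  then show ?thesis by simp
qed

lemma powi_minus_le_iff:
  fixes b :: real
  assumes "b > 1"
  shows "b powi (- i) \<le> b powi (- j) \<longleftrightarrow> j \<le> i"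
proof
  assume *: "b powi (- i) \<le> b powi (- j)"
  show "j \<le> i"
  proof (rule ccontr)
    assume "\<not> j \<le> i"
    then have "b powi (- j) < b powi (- i)"
      using assms by (intro power_int_strict_increasing) auto
    with * show False by simp
  qed
next
  assume "j \<le> i"
  then show "b powi (- i) \<le> b powi (- j)"
    using assms by (intro power_int_increasing) auto
qed

text \<open>The closed ball of radius s^-l around 0, so a larger l means a smaller ball. Stated
  through coefficients, it is visibly a subgroup and zero is no exception.\<close>

definition fball :: "int \<Rightarrow> 'a::{field,finite} fls set" where
  "fball l = {x. \<forall>i<l. fls_nth x i = 0}"

lemma fball_zero [simp]: "0 \<in> fball l"
  by (simp add: fball_def)

lemma fball_add: "x \<in> fball l \<Longrightarrow> y \<in> fball l \<Longrightarrow> x + y \<in> fball l"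
  by (simp add: fball_def)

lemma fball_diff: "x \<in> fball l \<Longrightarrow> y \<in> fball l \<Longrightarrow> x - y \<in> fball l"
  by (simp add: fball_def)

lemma fball_uminus: "x \<in> fball l \<Longrightarrow> - x \<in> fball l"
  by (simp add: fball_def)

lemma fball_sum: "(\<And>i. i \<in> I \<Longrightarrow> f i \<in> fball l) \<Longrightarrow> (\<Sum>i\<in>I. f i) \<in> fball l"
  by (induction I rule: infinite_finite_induct) (auto intro: fball_add)

lemma fball_mono: "x \<in> fball l' \<Longrightarrow> l \<le> l' \<Longrightarrow> x \<in> fball l"
  by (auto simp: fball_def)

lemma fball_iff: "x \<in> fball l \<longleftrightarrow> x = 0 \<or> l \<le> fls_subdegree x"
  by (auto simp: fball_def intro: fls_subdegree_geI)

lemma fball_mult: "x \<in> fball a \<Longrightarrow> y \<in> fball b \<Longrightarrow> x * y \<in> fball (a + b)"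
  by (cases "x = 0"; cases "y = 0") (auto simp: fball_iff)

lemma fball_divide: "x \<in> fball a \<Longrightarrow> y \<noteq> 0 \<Longrightarrow> x / y \<in> fball (a - fls_subdegree y)"
  by (cases "x = 0") (auto simp: fball_iff divide_inverse)

lemma fball_absval: "x \<in> fball l \<longleftrightarrow> absval x \<le> real CARD('a) powi (- l)"
  for x :: "'a::{field,finite} fls"
  using card_gt_1[where 'a='a] by (auto simp: fball_iff absval_def powi_minus_le_iff simp del: power_int_minus)

lemma open_fls_fball: "open S \<longleftrightarrow> (\<forall>a\<in>S. \<exists>t. \<forall>y\<in>fball t. a + y \<in> S)"
  for S :: "'a::{field,finite} fls set"
  unfolding open_fls_absval
proof (intro ball_cong refl iffI)
  note s = card_gt_1[where 'a='a]
  fix a assume "\<exists>r>0. {y. absval (y - a) < r} \<subseteq> S"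
  then obtain r where r: "r > 0" "{y. absval (y - a) < r} \<subseteq> S" by auto
  have "inverse (real CARD('a)) < 1" using s by (simp add: inverse_less_1_iff)
  then obtain N where N: "inverse (real CARD('a)) ^ N < r"
    using real_arch_pow_inv \<open>r > 0\<close> by blast
  then have "a + y \<in> S" if "y \<in> fball (int N)" for y
    using that r(2) by (auto simp: fball_absval power_int_minus power_inverse)
  then show "\<exists>t. \<forall>y\<in>fball t. a + y \<in> S" by blast
next
  note s = card_gt_1[where 'a='a]
  fix a assume "\<exists>t. \<forall>y\<in>fball t. a + y \<in> S"
  then obtain t where t: "\<And>y. y \<in> fball t \<Longrightarrow> a + y \<in> S" by blast
  have "{y. absval (y - a) < real CARD('a) powi (- t)} \<subseteq> S"
  proof
    fix y assume "y \<in> {y. absval (y - a) < real CARD('a) powi (- t)}"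
    then have "y - a \<in> fball t" by (simp add: fball_absval)
    from t[OF this] show "y \<in> S" by simp
  qed
  then show "\<exists>r>0. {y. absval (y - a) < r} \<subseteq> S"
    using s by (intro exI[of _ "real CARD('a) powi (- t)"]) auto
qed

subsection \<open>Polynomials inside the field of Laurent series\<close>

lemma poly_to_k_0 [simp]: "poly_to_k 0 = 0"
  by (simp add: poly_to_k_def)

lemma poly_to_k_pCons: "poly_to_k (pCons a p) = fls_const a + fls_X_inv * poly_to_k p"
  by (simp add: poly_to_k_def map_poly_pCons)

lemma fls_nth_poly_to_k: "fls_nth (poly_to_k p) i = (if i \<le> 0 then coeff p (nat (- i)) else 0)"
proof (induction p arbitrary: i)
  case (pCons a p)
  consider "i > 0" | "i = 0" | "i < 0" by linarith
  then show ?case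
  proof cases
    case 3
    then have "nat (- i) = Suc (nat (- (i + 1)))" by simp
    then show ?thesis using 3
      by (simp add: poly_to_k_pCons fls_X_inv_times_conv_shift pCons.IH del: minus_add_distrib)
  qed (simp_all add: poly_to_k_pCons fls_X_inv_times_conv_shift pCons.IH)
qed simp

lemma poly_to_k_add: "poly_to_k (p + q) = poly_to_k p + poly_to_k q"
  by (intro fls_eqI) (simp add: fls_nth_poly_to_k)

lemma poly_to_k_diff: "poly_to_k (p - q) = poly_to_k p - poly_to_k q"
  by (intro fls_eqI) (simp add: fls_nth_poly_to_k)

lemma poly_to_k_uminus: "poly_to_k (- p) = - poly_to_k p"
  by (intro fls_eqI) (simp add: fls_nth_poly_to_k)

lemma poly_to_k_smult: "poly_to_k (smult c p) = fls_const c * poly_to_k p"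
  by (intro fls_eqI) (simp add: fls_nth_poly_to_k)

lemma poly_to_k_mult: "poly_to_k (p * q) = poly_to_k p * poly_to_k q"
proof (induction p)
  case (pCons a p)
  have "poly_to_k (pCons a p * q) = poly_to_k (smult a q) + poly_to_k (pCons 0 (p * q))"
    by (simp add: poly_to_k_add)
  also have "\<dots> = fls_const a * poly_to_k q + fls_X_inv * (poly_to_k p * poly_to_k q)"
    by (simp add: poly_to_k_smult poly_to_k_pCons pCons.IH)
  finally show ?case by (simp add: poly_to_k_pCons algebra_simps)
qed simp

lemma poly_to_k_sum: "poly_to_k (\<Sum>i\<in>I. f i) = (\<Sum>i\<in>I. poly_to_k (f i))"
  by (induction I rule: infinite_finite_induct) (auto simp: poly_to_k_add)

lemma poly_to_k_eq_iff [simp]: "poly_to_k p = poly_to_k q \<longleftrightarrow> p = q"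
proof
  assume *: "poly_to_k p = poly_to_k q"
  show "p = q"
  proof (rule poly_eqI)
    fix n
    have "fls_nth (poly_to_k p) (- int n) = fls_nth (poly_to_k q) (- int n)" by (simp add: *)
    then show "coeff p n = coeff q n" by (simp add: fls_nth_poly_to_k)
  qed
qed auto

lemma poly_to_k_eq_0_iff [simp]: "poly_to_k p = 0 \<longleftrightarrow> p = 0"
  using poly_to_k_eq_iff[of p 0] by simp

definition polys_below :: "nat \<Rightarrow> 'a::{field,finite} poly set" where
  "polys_below d = {p. \<forall>i\<ge>d. coeff p i = 0}"

lemma polys_below_iff: "p \<in> polys_below d \<longleftrightarrow> p = 0 \<or> degree p < d"
proof (cases "p = 0")
  case False
  then have "lead_coeff p \<noteq> 0" by simp
  then show ?thesis
    by (auto simp: polys_below_def not_less[symmetric] intro: coeff_eq_0)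
qed (simp add: polys_below_def)

lemma polys_below_0 [simp]: "polys_below 0 = {0}"
  by (auto simp: polys_below_iff)

lemma zero_polys_below [simp]: "0 \<in> polys_below d"
  by (simp add: polys_below_iff)

lemma polys_below_diff: "p \<in> polys_below d \<Longrightarrow> q \<in> polys_below d \<Longrightarrow> p - q \<in> polys_below d"
  by (simp add: polys_below_def)

lemma polys_below_Suc: "polys_below (Suc d) = (\<lambda>(a, p). pCons a p) ` (UNIV \<times> polys_below d)"
proof (intro equalityI subsetI)
  fix p :: "'a poly" assume "p \<in> polys_below (Suc d)"
  then show "p \<in> (\<lambda>(a, p). pCons a p) ` (UNIV \<times> polys_below d)"
    by (cases p) (auto simp: polys_below_def coeff_pCons image_iff split: nat.splits)
next
  fix p :: "'a poly" assume "p \<in> (\<lambda>(a, p). pCons a p) ` (UNIV \<times> polys_below d)"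
  then show "p \<in> polys_below (Suc d)"
    by (auto simp: polys_below_def coeff_pCons split: nat.splits)
qed

lemma finite_card_polys_below:
  "finite (polys_below d :: 'a::{field,finite} poly set) \<and>
   card (polys_below d :: 'a poly set) = CARD('a) ^ d"
proof (induction d)
  case (Suc d)
  have "inj_on (\<lambda>(a, p). pCons a p) (UNIV \<times> polys_below d :: ('a \<times> 'a poly) set)"
    by (auto simp: inj_on_def)
  then show ?case using Suc by (simp add: polys_below_Suc card_image card_cartesian_product)
qed auto

lemmas finite_polys_below [simp] = finite_card_polys_below[THEN conjunct1]
lemmas card_polys_below = finite_card_polys_below[THEN conjunct2]

lemma poly_to_k_fball_iff: "poly_to_k p \<in> fball (1 - int d) \<longleftrightarrow> p \<in> polys_below d"
proof
  assume *: "poly_to_k p \<in> fball (1 - int d)"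
  show "p \<in> polys_below d"
    unfolding polys_below_def
  proof (intro CollectI allI impI)
    fix i assume "d \<le> i"
    then have "fls_nth (poly_to_k p) (- int i) = 0" using * by (auto simp: fball_def)
    then show "coeff p i = 0" by (simp add: fls_nth_poly_to_k)
  qed
qed (auto simp: polys_below_def fball_def fls_nth_poly_to_k)

lemma poly_to_k_fball_1_iff: "poly_to_k p \<in> fball 1 \<longleftrightarrow> p = 0"
  using poly_to_k_fball_iff[of p 0] by auto

lemma fls_subdegree_poly_to_k: "fls_subdegree (poly_to_k p) = - int (degree p)"
proof (cases "p = 0")
  case False
  then show ?thesis
    by (intro fls_subdegree_eqI) (auto simp: fls_nth_poly_to_k coeff_eq_0)
qed auto

text \<open>Only finitely many coefficients of x have index at most 0, and they form a polynomial in
  X. By \<open>poly_to_k_fball_1_iff\<close> the ball \<open>fball 1\<close> is thus a fundamental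
  domain for Z in k; \<open>fball 0\<close> would also contain the constants.\<close>

lemma integer_part: "\<exists>p. x - poly_to_k p \<in> fball 1"
proof -
  obtain N where N: "\<And>n. n < N \<Longrightarrow> fls_nth x n = 0"
    using fls_nth_vanishes_belowE by blast
  have "\<forall>\<^sub>\<infinity>n. fls_nth x (- int n) = 0"
    unfolding MOST_nat
    by (rule exI[of _ "nat (- N)"]) (auto intro!: N)
  then have "coeff (Abs_poly (\<lambda>n. fls_nth x (- int n))) = (\<lambda>n. fls_nth x (- int n))"
    by (intro Abs_poly_inverse) simp
  then show ?thesis
    by (intro exI[of _ "Abs_poly (\<lambda>n. fls_nth x (- int n))"])
       (auto simp: fball_def fls_nth_poly_to_k)
qed

text \<open>This is X^t; the sign changes because the series variable is X^-1.\<close>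

definition Xpow :: "int \<Rightarrow> 'a::{field,finite} fls" where
  "Xpow t = fls_X_intpow (- t)"

lemma Xpow_mult: "Xpow t * x = fls_shift t x"
  by (simp add: Xpow_def fls_shifted_times_simps)

lemma fball_Xpow_mult_iff: "Xpow t * x \<in> fball l \<longleftrightarrow> x \<in> fball (l + t)"
proof
  assume *: "Xpow t * x \<in> fball l"
  show "x \<in> fball (l + t)"
    unfolding fball_def
  proof (intro CollectI allI impI)
    fix i assume "i < l + t"
    then have "fls_nth (Xpow t * x) (i - t) = 0" using * by (auto simp: fball_def)
    then show "fls_nth x i = 0" by (simp add: Xpow_mult)
  qed
qed (simp add: fball_def Xpow_mult)

lemma Xpow_inverse: "Xpow t * Xpow (- t) = (1 :: 'a::{field,finite} fls)"
  by (simp only: Xpow_mult) (simp add: Xpow_def)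

lemma poly_to_k_monom: "poly_to_k (monom 1 t) = Xpow (int t)"
  by (intro fls_eqI) (auto simp: fls_nth_poly_to_k Xpow_def)

text \<open>The points \<open>X\<^sup>1\<^sup>-\<^sup>l r\<close> with \<open>deg r < d\<close> represent the balls of radius \<open>s\<^sup>-\<^sup>l\<close>
  inside the ball of radius \<open>s\<^sup>d\<^sup>-\<^sup>l\<close>.\<close>

lemma ball_representative_exists:
  assumes "x \<in> fball (l - int d)"
  shows "\<exists>r\<in>polys_below d. x - Xpow (1 - l) * poly_to_k r \<in> fball l"
proof -
  \<comment> \<open>Multiplication by X^(l-1) maps \<open>fball l\<close> onto
    \<open>fball 1\<close>, so r is the integer part of the scaled point.\<close>
  obtain r where r: "Xpow (l - 1) * x - poly_to_k r \<in> fball 1"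
    using integer_part by blast
  have eq: "Xpow (l - 1) * (x - Xpow (1 - l) * poly_to_k r) = Xpow (l - 1) * x - poly_to_k r"
    using Xpow_inverse[of "l - 1", where 'a='a]
    by (simp add: right_diff_distrib mult.assoc[symmetric])
  have "Xpow (l - 1) * x \<in> fball (1 - int d)" using assms by (simp add: fball_Xpow_mult_iff)
  moreover have "Xpow (l - 1) * x - poly_to_k r \<in> fball (1 - int d)"
    using fball_mono[OF r] by simp
  ultimately have "poly_to_k r \<in> fball (1 - int d)"
    using fball_diff[of "Xpow (l - 1) * x" _ "Xpow (l - 1) * x - poly_to_k r"] by simp
  then have "r \<in> polys_below d" by (simp add: poly_to_k_fball_iff)
  moreover have "x - Xpow (1 - l) * poly_to_k r \<in> fball l"
    using r unfolding eq[symmetric] fball_Xpow_mult_iff by simp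
  ultimately show ?thesis by blast
qed

lemma ball_representative_unique:
  assumes "Xpow (1 - l) * poly_to_k r - Xpow (1 - l) * poly_to_k r' \<in> fball l"
  shows "r = r'"
proof -
  have "Xpow (1 - l) * poly_to_k (r - r') \<in> fball l"
    using assms by (simp add: poly_to_k_diff right_diff_distrib)
  then have "r - r' = 0" unfolding fball_Xpow_mult_iff by (simp add: poly_to_k_fball_1_iff)
  then show ?thesis by simp
qed

lemma ball_representative_fball:
  "r \<in> polys_below d \<Longrightarrow> Xpow (1 - l) * poly_to_k r \<in> fball (l - int d)"
  unfolding fball_Xpow_mult_iff by (simp add: poly_to_k_fball_iff)

subsection \<open>Balls of vectors and matrices\<close>

definition vball :: "int \<Rightarrow> ('a::{field,finite} fls ^ 'n) set" where
  "vball l = {v. \<forall>i. v $ i \<in> fball l}"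

definition mball :: "int \<Rightarrow> ('a::{field,finite} fls ^ 'n ^ 'm) set" where
  "mball l = {A. \<forall>i j. A $ i $ j \<in> fball l}"

lemma vball_zero [simp]: "0 \<in> vball l"
  by (simp add: vball_def)

lemma vball_add: "v \<in> vball l \<Longrightarrow> w \<in> vball l \<Longrightarrow> v + w \<in> vball l"
  by (simp add: vball_def fball_add)

lemma vball_diff: "v \<in> vball l \<Longrightarrow> w \<in> vball l \<Longrightarrow> v - w \<in> vball l"
  by (simp add: vball_def fball_diff)

lemma vball_mono: "v \<in> vball l' \<Longrightarrow> l \<le> l' \<Longrightarrow> v \<in> vball l"
  by (auto simp: vball_def intro: fball_mono)

lemma vball_add_iff: "w \<in> vball l \<Longrightarrow> v + w \<in> vball l \<longleftrightarrow> v \<in> vball l"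
  using vball_add[of v l w] vball_diff[of "v + w" l w] by auto

lemma mball_add: "A \<in> mball l \<Longrightarrow> B \<in> mball l \<Longrightarrow> A + B \<in> mball l"
  by (simp add: mball_def fball_add)

lemma mball_diff: "A \<in> mball l \<Longrightarrow> B \<in> mball l \<Longrightarrow> A - B \<in> mball l"
  by (simp add: mball_def fball_diff)

lemma mball_add_iff: "B \<in> mball l \<Longrightarrow> A + B \<in> mball l \<longleftrightarrow> A \<in> mball l"
  using mball_add[of A l B] mball_diff[of "A + B" l B] by auto

lemma mball_mono: "A \<in> mball l' \<Longrightarrow> l \<le> l' \<Longrightarrow> A \<in> mball l"
  by (auto simp: mball_def intro: fball_mono)

lemma mball_mult: "A \<in> mball a \<Longrightarrow> v \<in> vball b \<Longrightarrow> A *v v \<in> vball (a + b)"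
  by (auto simp: mball_def vball_def matrix_vector_mult_def intro!: fball_sum fball_mult)

lemma vball_sup_norm: "v \<in> vball l \<longleftrightarrow> sup_norm v \<le> real CARD('a) powi (- l)"
  for v :: "'a::{field,finite} fls ^ 'n"
  by (auto simp: vball_def sup_norm_def fball_absval)

lemma mball_0_eq: "mball 0 = unit_matrices"
  by (auto simp: mball_def unit_matrices_def mat_sup_norm_def fball_absval)

lemma open_vball_iff: "open S \<longleftrightarrow> (\<forall>v\<in>S. \<exists>t. \<forall>w\<in>vball t. v + w \<in> S)"
  for S :: "('a::{field,finite} fls ^ 'n) set"
proof
  assume S: "open S"
  show "\<forall>v\<in>S. \<exists>t. \<forall>w\<in>vball t. v + w \<in> S"
  proof
    fix v assume "v \<in> S"
    with S obtain f where f: "\<And>i. open (f i)" "\<And>i. v $ i \<in> f i"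
      "\<And>y. (\<And>i. y $ i \<in> f i) \<Longrightarrow> y \<in> S"
      unfolding open_vec_def by metis
    have "\<forall>i. \<exists>t. \<forall>y\<in>fball t. v $ i + y \<in> f i"
      using f(1,2) by (auto simp: open_fls_fball)
    then obtain t where t: "\<And>i y. y \<in> fball (t i) \<Longrightarrow> v $ i + y \<in> f i" by metis
    have "v + w \<in> S" if "w \<in> vball (Max (range t))" for w
    proof (rule f(3))
      fix i
      have "t i \<le> Max (range t)" by simp
      with that have "w $ i \<in> fball (t i)" by (auto simp: vball_def intro: fball_mono)
      then show "(v + w) $ i \<in> f i" by (simp add: t)
    qed
    then show "\<exists>t. \<forall>w\<in>vball t. v + w \<in> S" by blast
  qed
next
  assume *: "\<forall>v\<in>S. \<exists>t. \<forall>w\<in>vball t. v + w \<in> S"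
  show "open S"
    unfolding open_vec_def
  proof
    fix v assume "v \<in> S"
    with * obtain t where t: "\<And>w. w \<in> vball t \<Longrightarrow> v + w \<in> S" by metis
    have "open {z. z - c \<in> fball t}" for c :: "'a fls"
      unfolding open_fls_fball
      by (auto intro!: exI[of _ t]) (metis add_diff_eq add.commute fball_add)
    moreover have "v $ i \<in> {z. z - v $ i \<in> fball t}" for i by simp
    moreover have "y \<in> S" if "\<And>i. y $ i \<in> {z. z - v $ i \<in> fball t}" for y
      using t[of "y - v"] that by (simp add: vball_def)
    ultimately show "\<exists>f. (\<forall>i. open (f i) \<and> v $ i \<in> f i) \<and> (\<forall>y. (\<forall>i. y $ i \<in> f i) \<longrightarrow> y \<in> S)"
      by (intro exI[of _ "\<lambda>i. {z. z - v $ i \<in> fball t}"]) blast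
  qed
qed

lemma open_mball_iff: "open S \<longleftrightarrow> (\<forall>A\<in>S. \<exists>t. \<forall>B\<in>mball t. A + B \<in> S)"
  for S :: "('a::{field,finite} fls ^ 'n ^ 'm) set"
proof
  assume S: "open S"
  show "\<forall>A\<in>S. \<exists>t. \<forall>B\<in>mball t. A + B \<in> S"
  proof
    fix A assume "A \<in> S"
    with S obtain f where f: "\<And>i. open (f i)" "\<And>i. A $ i \<in> f i"
      "\<And>y. (\<And>i. y $ i \<in> f i) \<Longrightarrow> y \<in> S"
      unfolding open_vec_def by metis
    have "\<forall>i. \<exists>t. \<forall>y\<in>vball t. A $ i + y \<in> f i"
      using f(1,2) by (auto simp: open_vball_iff)
    then obtain t where t: "\<And>i y. y \<in> vball (t i) \<Longrightarrow> A $ i + y \<in> f i" by metis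
    have "A + B \<in> S" if "B \<in> mball (Max (range t))" for B
    proof (rule f(3))
      fix i
      have "t i \<le> Max (range t)" by simp
      moreover have "B $ i $ j \<in> fball (Max (range t))" for j
        using that by (simp add: mball_def)
      ultimately have "B $ i \<in> vball (t i)"
        using fball_mono unfolding vball_def by blast
      then show "(A + B) $ i \<in> f i" by (simp add: t)
    qed
    then show "\<exists>t. \<forall>B\<in>mball t. A + B \<in> S" by blast
  qed
next
  assume *: "\<forall>A\<in>S. \<exists>t. \<forall>B\<in>mball t. A + B \<in> S"
  show "open S"
  proof (subst open_vec_def, rule ballI)
    fix A assume "A \<in> S"
    with * obtain t where t: "\<And>B. B \<in> mball t \<Longrightarrow> A + B \<in> S" by metis
    have "open {z. z - c \<in> vball t}" for c :: "'a fls ^ 'n"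
      unfolding open_vball_iff
      by (auto intro!: exI[of _ t]) (metis add_diff_eq add.commute vball_add)
    moreover have "A $ i \<in> {z. z - A $ i \<in> vball t}" for i by simp
    moreover have "y \<in> S" if "\<And>i. y $ i \<in> {z. z - A $ i \<in> vball t}" for y
      using t[of "y - A"] that by (simp add: vball_def mball_def)
    ultimately show "\<exists>f. (\<forall>i. open (f i) \<and> A $ i \<in> f i) \<and> (\<forall>y. (\<forall>i. y $ i \<in> f i) \<longrightarrow> y \<in> S)"
      by (intro exI[of _ "\<lambda>i. {z. z - A $ i \<in> vball t}"]) blast
  qed
qed

definition poly_matrix :: "'a::{field,finite} poly ^ 'n ^ 'm \<Rightarrow> 'a fls ^ 'n ^ 'm" where
  "poly_matrix C = (\<chi> i j. poly_to_k (C $ i $ j))"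

lemma poly_matrix_mult: "poly_matrix C *v vec_to_k q = vec_to_k (C *v q)"
  by (simp add: poly_matrix_def vec_to_k_def matrix_vector_mult_def vec_eq_iff
      poly_to_k_sum poly_to_k_mult)

lemma poly_matrix_uminus: "poly_matrix (- C) = - poly_matrix C"
  by (simp add: poly_matrix_def vec_eq_iff poly_to_k_uminus)

lemma vec_to_k_nth: "vec_to_k q $ i = poly_to_k (q $ i)"
  by (simp add: vec_to_k_def)

lemma vec_to_k_diff: "vec_to_k (p - q) = vec_to_k p - vec_to_k q"
  by (simp add: vec_to_k_def vec_eq_iff poly_to_k_diff)

lemma integer_part_matrix: "\<exists>C. A - poly_matrix C \<in> mball 1"
proof -
  obtain c where "\<And>i j. A $ i $ j - poly_to_k (c i j) \<in> fball 1"
    using integer_part[of "A $ _ $ _"] by metis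
  then show ?thesis
    by (intro exI[of _ "\<chi> i j. c i j"]) (simp add: mball_def poly_matrix_def)
qed

text \<open>Conditions that see the digits of the entries only before a fixed position t. They
  define clopen sets, and because t does not depend on A, such a set can be cut into balls of one
  common radius.\<close>

definition stable :: "('a::{field,finite} fls ^ 'n ^ 'm \<Rightarrow> bool) \<Rightarrow> bool" where
  "stable P \<longleftrightarrow> (\<exists>t. \<forall>A. \<forall>B\<in>mball t. P (A + B) \<longleftrightarrow> P A)"

lemma stableI: "(\<And>A B. B \<in> mball t \<Longrightarrow> P (A + B) \<longleftrightarrow> P A) \<Longrightarrow> stable P"
  unfolding stable_def by blast

lemma stable_conj:
  assumes "stable P" "stable Q"
  shows "stable (\<lambda>A. P A \<and> Q A)"
proof -
  from assms obtain t u where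
    "\<And>A B. B \<in> mball t \<Longrightarrow> P (A + B) \<longleftrightarrow> P A" "\<And>A B. B \<in> mball u \<Longrightarrow> Q (A + B) \<longleftrightarrow> Q A"
    unfolding stable_def by blast
  then show ?thesis by (intro stableI[of "max t u"]) (meson max.cobounded1 max.cobounded2 mball_mono)
qed

lemma stable_not: "stable P \<Longrightarrow> stable (\<lambda>A. \<not> P A)"
  unfolding stable_def by blast

lemma stable_True: "stable (\<lambda>A. True)"
  by (rule stableI) auto

lemma stable_ball:
  assumes "finite I" "\<And>i. i \<in> I \<Longrightarrow> stable (P i)"
  shows "stable (\<lambda>A. \<forall>i\<in>I. P i A)"
  using assms by (induction I) (auto intro: stable_conj stable_True)

lemma stable_bex:
  assumes "finite I" "\<And>i. i \<in> I \<Longrightarrow> stable (P i)"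
  shows "stable (\<lambda>A. \<exists>i\<in>I. P i A)"
  using stable_not[OF stable_ball[of I "\<lambda>i A. \<not> P i A"]] assms by (simp add: stable_not)

lemma stable_mball: "stable (\<lambda>A. A \<in> mball l)"
  by (rule stableI[of l]) (metis add_diff_cancel_right' mball_add mball_diff)

lemma stable_open: "stable P \<Longrightarrow> open {A. P A}"
  unfolding open_mball_iff stable_def by auto

lemma vball_exists: "\<exists>b. v \<in> vball b" for v :: "'a::{field,finite} fls ^ 'n"
proof -
  have "v \<in> vball (Min (range (\<lambda>i. fls_subdegree (v $ i))))"
    by (auto simp: vball_def fball_iff)
  then show ?thesis by blast
qed

lemma stable_vball_mult: "\<exists>t. \<forall>B\<in>mball t. B *v v \<in> vball l"
proof -
  obtain b where "v \<in> vball b" using vball_exists by blast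
  then show ?thesis
    by (intro exI[of _ "l - b"]) (use mball_mult[where b=b] in fastforce)
qed

lemma stable_affine: "stable (\<lambda>A :: 'a::{field,finite} fls ^ 'n ^ 'm. w + A *v v \<in> vball l)"
proof -
  obtain t where "\<And>B :: 'a fls ^ 'n ^ 'm. B \<in> mball t \<Longrightarrow> B *v v \<in> vball l"
    using stable_vball_mult by metis
  then show ?thesis
    by (intro stableI[of t])
       (simp add: matrix_vector_mult_add_rdistrib add.assoc[symmetric] vball_add_iff)
qed

text \<open>The position t depends on v and l only and serves all p at once, so the quantifier over
  infinitely many p is harmless here, in contrast to \<open>stable_bex\<close>.\<close>

lemma stable_ex_affine: "stable (\<lambda>A :: 'a::{field,finite} fls ^ 'n ^ 'm. \<exists>p. w p + A *v v \<in> vball l)"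
proof -
  obtain t where "\<And>B :: 'a fls ^ 'n ^ 'm. B \<in> mball t \<Longrightarrow> B *v v \<in> vball l"
    using stable_vball_mult by metis
  then show ?thesis
    by (intro stableI[of t])
       (simp add: matrix_vector_mult_add_rdistrib add.assoc[symmetric] vball_add_iff)
qed

subsection \<open>Haar measure on the unit ball\<close>

text \<open>Besides \<mu> itself, the measures \<open>rescaled t\<close> are instances of this
  locale. This is how estimates on the unit ball are carried over to smaller balls.\<close>

locale haar_matrices =
  fixes \<mu> :: "('a::{field,finite} fls ^ 'n ^ 'm) measure"
  assumes sets_eq: "sets \<mu> = sets borel"
    and translate: "E \<in> sets borel \<Longrightarrow> emeasure \<mu> ((\<lambda>A. B + A) ` E) = emeasure \<mu> E"
    and unit: "emeasure \<mu> (mball 0) = 1"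
begin

definition unit_ball :: "('a fls ^ 'n ^ 'm) measure" where
  "unit_ball = restrict_space \<mu> (mball 0)"

lemma stable_borel: "stable P \<Longrightarrow> {A. P A} \<in> sets borel"
  by (simp add: stable_open)

lemma mball_borel: "mball l \<in> sets borel"
  using stable_borel[OF stable_mball] by simp

lemma space_mu: "space \<mu> = UNIV"
  using sets_eq_imp_space_eq[OF sets_eq] by simp

lemma space_unit_ball: "space unit_ball = mball 0"
  by (simp add: unit_ball_def space_restrict_space space_mu)

lemma sets_unit_ball: "S \<in> sets unit_ball \<longleftrightarrow> S \<in> sets borel \<and> S \<subseteq> mball 0"
  by (auto simp: unit_ball_def sets_restrict_space_iff sets_eq space_mu mball_borel)

lemma emeasure_unit_ball: "S \<subseteq> mball 0 \<Longrightarrow> emeasure unit_ball S = emeasure \<mu> S"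
  unfolding unit_ball_def
  by (rule emeasure_restrict_space) (auto simp: space_mu sets_eq mball_borel)

lemma prob_space_unit_ball: "prob_space unit_ball"
  by (rule prob_spaceI) (simp add: space_unit_ball emeasure_unit_ball unit)

sublocale prob_space unit_ball
  by (rule prob_space_unit_ball)

lemma event_sets: "stable P \<Longrightarrow> {A \<in> mball 0. P A} \<in> events"
  using sets.Int[OF mball_borel[of 0] stable_borel[of P]] by (auto simp: sets_unit_ball Int_def)

lemma prob_translate:
  assumes "stable P" "B \<in> mball 0"
  shows "prob {A \<in> mball 0. P (A - B)} = prob {A \<in> mball 0. P A}"
proof -
  have *: "{A \<in> mball 0. P (A - B)} = (\<lambda>A. B + A) ` {A \<in> mball 0. P A}"
  proof (intro equalityI subsetI)
    fix A assume "A \<in> {A \<in> mball 0. P (A - B)}"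
    then show "A \<in> (\<lambda>A. B + A) ` {A \<in> mball 0. P A}"
      using assms(2) by (intro image_eqI[of _ _ "A - B"]) (auto intro: mball_diff)
  qed (use assms(2) in \<open>auto intro: mball_add\<close>)
  have "{A \<in> mball 0. P A} \<in> sets borel"
    using event_sets[OF assms(1)] by (simp add: sets_unit_ball)
  then have "emeasure unit_ball {A \<in> mball 0. P (A - B)} = emeasure unit_ball {A \<in> mball 0. P A}"
    using assms(2) by (subst (1 2) emeasure_unit_ball) (auto simp: * translate intro: mball_add)
  then show ?thesis by (simp add: measure_def)
qed

text \<open>Since \<open>k\<close> is the sum of \<open>Z\<close> and the unit ball, an event periodic under \<open>Z\<close>-matrices
  can be translated by arbitrary matrices over \<open>k\<close>.\<close>

lemma prob_translate_periodic:
  assumes "stable P" "\<And>A C. P (A + poly_matrix C) \<longleftrightarrow> P A"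
  shows "prob {A \<in> mball 0. P (A - B)} = prob {A \<in> mball 0. P A}"
proof -
  obtain C where C: "B - poly_matrix C \<in> mball 1" using integer_part_matrix by blast
  have "P (A - B) \<longleftrightarrow> P (A - (B - poly_matrix C))" for A
    using assms(2)[of "A - B" C] by (simp add: algebra_simps)
  then have "prob {A \<in> mball 0. P (A - B)} = prob {A \<in> mball 0. P (A - (B - poly_matrix C))}"
    by simp
  also have "\<dots> = prob {A \<in> mball 0. P A}"
    using mball_mono[OF C, of 0] by (intro prob_translate assms(1)) simp
  finally show ?thesis .
qed

lemma prob_equal_parts:
  assumes "finite Y" "\<And>y. y \<in> Y \<Longrightarrow> stable (P y)"
    and disj: "\<And>A y y'. A \<in> mball 0 \<Longrightarrow> y \<in> Y \<Longrightarrow> y' \<in> Y \<Longrightarrow> P y A \<Longrightarrow> P y' A \<Longrightarrow> y = y'"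
    and const: "\<And>y. y \<in> Y \<Longrightarrow> prob {A \<in> mball 0. P y A} = c"
  shows "prob {A \<in> mball 0. \<exists>y\<in>Y. P y A} = real (card Y) * c"
proof -
  have "prob {A \<in> mball 0. \<exists>y\<in>Y. P y A} = prob (\<Union>y\<in>Y. {A \<in> mball 0. P y A})"
    by (rule arg_cong[where f=prob]) auto
  also have "\<dots> = (\<Sum>y\<in>Y. prob {A \<in> mball 0. P y A})"
    by (rule finite_measure_finite_Union)
       (use assms disj in \<open>auto simp: disjoint_family_on_def intro!: event_sets\<close>)
  finally show ?thesis using const by simp
qed

text \<open>The fractional parts of the \<open>f A d\<close> are equidistributed: the sets obtained from the one
  below by shifting the \<open>f A d\<close> all have the same measure, and sufficiently many are disjoint.\<close>

lemma prob_near_integers_le: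
  fixes f :: "'a fls ^ 'n ^ 'm \<Rightarrow> 'd::finite \<Rightarrow> 'a fls" and l :: "'d \<Rightarrow> nat"
  assumes add: "\<And>A B d. f (A + B) d = f A d + f B d"
    and poly: "\<And>C d. \<exists>p. f (poly_matrix C) d = poly_to_k p"
    and surj: "\<And>y. \<exists>B. \<forall>d. f B d = y d"
    and cont: "\<exists>t. \<forall>A\<in>mball t. \<forall>d. f A d \<in> fball (int (l d))"
    and l: "\<And>d. l d \<ge> 1"
  shows "prob {A \<in> mball 0. \<forall>d. \<exists>p. f A d + poly_to_k p \<in> fball (int (l d))}
      \<le> (\<Prod>d\<in>UNIV. 1 / real CARD('a) ^ (l d - 1))"
proof -
  define P where "P = (\<lambda>y A. \<forall>d. \<exists>p. f A d - y d + poly_to_k p \<in> fball (int (l d)))"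
  \<comment> \<open>For each d the shifts represent the s^(l d - 1) balls of radius s^-(l d) that
    make up \<open>fball 1\<close>.\<close>
  define Y where "Y = PiE UNIV (\<lambda>d. polys_below (l d - 1) :: 'a poly set)"
  define r where "r = (\<lambda>y d. Xpow (1 - int (l d)) * poly_to_k (y d :: 'a poly))"
  have stable: "stable (P y)" for y
  proof -
    from cont obtain t where t: "\<And>A d. A \<in> mball t \<Longrightarrow> f A d \<in> fball (int (l d))" by blast
    have "P y (A + B) \<longleftrightarrow> P y A" if "B \<in> mball t" for A B
    proof -
      have "f (A + B) d - y d + poly_to_k p \<in> fball (int (l d)) \<longleftrightarrow>
            f A d - y d + poly_to_k p \<in> fball (int (l d))" for d p
        using fball_add[OF _ t[OF that, of d], of "f A d - y d + poly_to_k p"]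
          fball_diff[OF _ t[OF that, of d], of "f A d - y d + poly_to_k p + f B d"]
        by (auto simp: add algebra_simps)
      then show ?thesis unfolding P_def by blast
    qed
    then show ?thesis by (rule stableI)
  qed
  have periodic: "P y (A + poly_matrix C) \<longleftrightarrow> P y A" for y A C
  proof -
    have imp: "P y (A + poly_matrix C)" if PA: "P y A" for A C
      unfolding P_def
    proof
      fix d
      obtain p where p: "f A d - y d + poly_to_k p \<in> fball (int (l d))"
        using PA unfolding P_def by blast
      obtain c where "f (poly_matrix C) d = poly_to_k c" using poly by blast
      with p have "f (A + poly_matrix C) d - y d + poly_to_k (p - c) \<in> fball (int (l d))"
        by (simp add: add poly_to_k_diff algebra_simps)
      then show "\<exists>p. f (A + poly_matrix C) d - y d + poly_to_k p \<in> fball (int (l d))" by blast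
    qed
    from imp[of A C] imp[of "A + poly_matrix C" "- C"] show ?thesis
      by (auto simp: poly_matrix_uminus)
  qed
  have const: "prob {A \<in> mball 0. P y A} = prob {A \<in> mball 0. P (\<lambda>_. 0) A}" for y
  proof -
    obtain B where B: "\<And>d. f B d = y d" using surj by blast
    have "f (A - B) d = f A d - y d" for A d
      using add[of "A - B" B d] B by simp
    then have "P y A \<longleftrightarrow> P (\<lambda>_. 0) (A - B)" for A unfolding P_def by simp
    then show ?thesis
      using prob_translate_periodic[of "P (\<lambda>_. 0)" B] stable periodic by simp
  qed
  have disj: "y = y'" if Y: "y \<in> Y" "y' \<in> Y" and PA: "P (r y) A" "P (r y') A" for y y' A
  proof
    fix d
    from PA obtain p p' where p: "f A d - r y d + poly_to_k p \<in> fball (int (l d))"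
      "f A d - r y' d + poly_to_k p' \<in> fball (int (l d))" unfolding P_def by blast
    have rd: "r y d - r y' d - poly_to_k (p - p') \<in> fball (int (l d))"
      using fball_diff[OF p(2,1)] by (simp add: poly_to_k_diff algebra_simps)
    have 1: "r z d \<in> fball 1" if "z \<in> Y" for z
      using ball_representative_fball[of "z d" "l d - 1" "int (l d)"] that l[of d]
      by (auto simp: r_def Y_def)
    \<comment> \<open>All shifts lie in \<open>fball 1\<close>, which contains no non-zero
      polynomial. Hence the integers p and p' agree, and the two shifts lie in the same small
      ball.\<close>
    have "r y d - r y' d - (r y d - r y' d - poly_to_k (p - p')) \<in> fball 1"
      using Y l[of d] by (intro fball_diff[OF fball_diff[OF 1 1] fball_mono[OF rd]]) auto
    then have "poly_to_k (p - p') \<in> fball 1" by simp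
    then have "p - p' = 0" unfolding poly_to_k_fball_1_iff .
    then have "r y d - r y' d \<in> fball (int (l d))"
      using rd by simp
    then show "y d = y' d" unfolding r_def by (rule ball_representative_unique)
  qed
  have "finite Y" unfolding Y_def by (intro finite_PiE) auto
  have "prob {A \<in> mball 0. \<exists>y\<in>Y. P (r y) A} = real (card Y) * prob {A \<in> mball 0. P (\<lambda>_. 0) A}"
    by (rule prob_equal_parts[OF \<open>finite Y\<close> stable]) (use disj const in auto)
  then have "real (card Y) * prob {A \<in> mball 0. P (\<lambda>_. 0) A} \<le> 1"
    using prob_le_1[of "{A \<in> mball 0. \<exists>y\<in>Y. P (r y) A}"] by simp
  moreover have "real (card Y) = (\<Prod>d\<in>UNIV. real CARD('a) ^ (l d - 1))"
    by (simp add: Y_def card_PiE card_polys_below)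
  moreover have "(\<Prod>d\<in>UNIV. real CARD('a) ^ (l d - 1)) > 0"
    by (intro prod_pos) simp
  ultimately have "prob {A \<in> mball 0. P (\<lambda>_. 0) A} \<le> (\<Prod>d\<in>UNIV. 1 / real CARD('a) ^ (l d - 1))"
    by (simp only: prod_dividef prod.neutral_const pos_le_divide_eq mult.commute)
  then show ?thesis by (simp add: P_def)
qed

text \<open>Since the entry k0 of q attains the largest degree j, the column k0 of A alone can move
  A q to any point of \<open>vball (- int j)\<close> without leaving the unit ball, so A q is
  uniformly distributed there. That ball contains -p and splits into s^((l+j)m) balls of radius
  s^-l.\<close>

lemma prob_affine:
  fixes q :: "'a poly ^ 'n" and p :: "'a poly ^ 'm"
  assumes q0: "q $ k0 \<noteq> 0" "degree (q $ k0) = j"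
    and q: "\<And>k. q $ k \<in> polys_below (Suc j)" and p: "\<And>i. p $ i \<in> polys_below (Suc j)"
  shows "prob {A \<in> mball 0. vec_to_k p + A *v vec_to_k q \<in> vball (int l)}
      = 1 / real CARD('a) ^ ((l + j) * CARD('m))"
proof -
  define P where "P = (\<lambda>(y :: 'a fls ^ 'm) A. A *v vec_to_k q - y \<in> vball (int l))"
  define Y where "Y = PiE (UNIV :: 'm set) (\<lambda>_. polys_below (l + j) :: 'a poly set)"
  define r where "r = (\<lambda>y. (\<chi> i. Xpow (1 - int l) * poly_to_k (y i :: 'a poly)) :: 'a fls ^ 'm)"
  define c where "c = prob {A \<in> mball 0. P (0 :: 'a fls ^ 'm) A}"
  have stable: "stable (P y)" for y
    unfolding P_def using stable_affine[of "- y"] by simp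
  have pk: "poly_to_k z \<in> fball (- int j)" if "z \<in> polys_below (Suc j)" for z :: "'a poly"
    using that poly_to_k_fball_iff[of z "Suc j"] by simp
  have vq: "vec_to_k q \<in> vball (- int j)"
    using q pk by (simp add: vball_def vec_to_k_def)
  have const: "prob {A \<in> mball 0. P y A} = c" if y: "y \<in> vball (- int j)" for y
  proof -
    define B :: "'a fls ^ 'n ^ 'm" where
      "B = (\<chi> i k. if k = k0 then y $ i / poly_to_k (q $ k0) else 0)"
    have Bq: "B *v vec_to_k q = y"
      using q0 by (simp add: B_def vec_eq_iff matrix_vector_mult_def vec_to_k_def if_distrib if_distribR
          cong: if_cong)
    have "y $ i / poly_to_k (q $ k0) \<in> fball 0" for i
      using fball_divide[of "y $ i" "- int j" "poly_to_k (q $ k0)"] y q0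
      by (simp add: vball_def fls_subdegree_poly_to_k)
    then have B0: "B \<in> mball 0" by (simp add: mball_def B_def)
    have "P y A \<longleftrightarrow> P 0 (A - B)" for A
      unfolding P_def by (simp add: matrix_vector_mult_diff_rdistrib Bq)
    then show ?thesis
      using prob_translate[OF stable B0] by (simp add: c_def)
  qed
  have r: "r y \<in> vball (- int j)" if "y \<in> Y" for y
    using that ball_representative_fball[of _ "l + j" "int l"]
    by (auto simp: vball_def r_def Y_def)
  have cover: "\<exists>y\<in>Y. P (r y) A" if "A \<in> mball 0" for A
  proof -
    have "(A *v vec_to_k q) $ i \<in> fball (int l - int (l + j))" for i
      using mball_mult[OF that vq] by (simp add: vball_def)
    then have "\<exists>z\<in>polys_below (l + j). (A *v vec_to_k q) $ i - Xpow (1 - int l) * poly_to_k z \<in> fball (int l)"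
      for i by (rule ball_representative_exists)
    then obtain z where "\<And>i. z i \<in> polys_below (l + j)"
      "\<And>i. (A *v vec_to_k q) $ i - Xpow (1 - int l) * poly_to_k (z i) \<in> fball (int l)" by metis
    then show ?thesis
      by (intro bexI[of _ z]) (auto simp: P_def r_def Y_def vball_def)
  qed
  have disj: "y = y'" if "P (r y) A" "P (r y') A" for y y' A
  proof
    fix i
    have "r y' - r y \<in> vball (int l)" using vball_diff[OF that[unfolded P_def]] by simp
    then have "Xpow (1 - int l) * poly_to_k (y' i) - Xpow (1 - int l) * poly_to_k (y i) \<in> fball (int l)"
      by (simp add: vball_def r_def)
    then have "y' i = y i" by (rule ball_representative_unique)
    then show "y i = y' i" ..
  qed
  have "finite Y" unfolding Y_def by (intro finite_PiE) auto
  have "prob {A \<in> mball 0. \<exists>y\<in>Y. P (r y) A} = real (card Y) * c"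
    by (rule prob_equal_parts[OF \<open>finite Y\<close> stable]) (use disj const r in auto)
  moreover have "{A \<in> mball 0. \<exists>y\<in>Y. P (r y) A} = space unit_ball"
    using cover by (auto simp: space_unit_ball)
  ultimately have "real (card Y) * c = 1" by (simp add: prob_space)
  moreover have "real (card Y) = real CARD('a) ^ ((l + j) * CARD('m))"
    by (simp add: Y_def card_PiE card_polys_below power_mult)
  ultimately have "c = 1 / real CARD('a) ^ ((l + j) * CARD('m))"
    by (metis nonzero_mult_div_cancel_left mult_zero_left zero_neq_one)
  moreover have "prob {A \<in> mball 0. P (- vec_to_k p) A} = c"
    using p pk fball_uminus by (intro const) (auto simp: vball_def vec_to_k_def)
  ultimately show ?thesis by (simp add: P_def add.commute)
qed

end

subsection \<open>A lower bound for the probability of a union\<close>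

text \<open>Cauchy--Schwarz in quadratic form: let N count the events that occur, so that N vanishes
  outside their union U. The expectation of (N - c 1_U)^2 is non-negative for every c, and c = S /
  prob U is the optimal choice.\<close>

lemma (in prob_space) chung_erdos:
  assumes "finite J" and E: "\<And>j. j \<in> J \<Longrightarrow> E j \<in> events"
  shows "(\<Sum>j\<in>J. prob (E j))\<^sup>2 \<le> prob (\<Union>j\<in>J. E j) * (\<Sum>i\<in>J. \<Sum>j\<in>J. prob (E i \<inter> E j))"
proof -
  define U where "U = (\<Union>j\<in>J. E j)"
  define S where "S = (\<Sum>j\<in>J. prob (E j))"
  define S2 where "S2 = (\<Sum>i\<in>J. \<Sum>j\<in>J. prob (E i \<inter> E j))"
  have U: "U \<in> events" unfolding U_def using assms by auto
  have key: "S2 - 2 * c * S + c\<^sup>2 * prob U \<ge> 0" for c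
  proof -
    define N where "N = (\<lambda>x. \<Sum>j\<in>J. indicator (E j) x :: real)"
    have N2: "(N x)\<^sup>2 = (\<Sum>i\<in>J. \<Sum>j\<in>J. indicator (E i \<inter> E j) x)" for x
      unfolding N_def power2_eq_square sum_product by (simp only: indicator_inter_arith)
    have NU: "N x * indicator U x = N x" for x
      by (auto simp: N_def U_def indicator_def intro!: sum.neutral)
    have eq: "(N x - c * indicator U x)\<^sup>2 =
        (\<Sum>i\<in>J. \<Sum>j\<in>J. indicator (E i \<inter> E j) x) - 2 * c * (\<Sum>j\<in>J. indicator (E j) x)
        + c\<^sup>2 * indicator U x" for x
    proof -
      have "(N x - c * indicator U x)\<^sup>2 = (N x)\<^sup>2 - 2 * c * (N x * indicator U x)
          + c\<^sup>2 * (indicator U x)\<^sup>2"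
        by (simp add: power2_diff power_mult_distrib algebra_simps)
      also have "(indicator U x :: real)\<^sup>2 = indicator U x"
        by (simp add: indicator_def)
      finally show ?thesis unfolding NU N2 by (simp only: N_def)
    qed
    have int: "integrable M (\<lambda>x. indicator A x :: real)" if "A \<in> events" for A
      using that by (intro integrable_real_indicator) (auto simp: less_top[symmetric])
    have "0 \<le> expectation (\<lambda>x. (N x - c * indicator U x)\<^sup>2)" by simp
    also have "\<dots> = S2 - 2 * c * S + c\<^sup>2 * prob U"
      unfolding eq S2_def S_def using assms U by (simp add: int)
    finally show ?thesis .
  qed
  have "S\<^sup>2 \<le> prob U * S2"
  proof (cases "prob U = 0")
    case True
    have "prob (E j) \<le> prob U" if "j \<in> J" for j
      using that U by (intro finite_measure_mono) (auto simp: U_def)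
    then have "S = 0" unfolding S_def using True
      by (intro sum.neutral) (simp add: measure_le_0_iff)
    then show ?thesis using True by simp
  next
    case False
    then have "prob U > 0" by (simp add: zero_less_measure_iff)
    then show ?thesis
      using key[of "S / prob U"] by (simp add: field_simps power2_eq_square)
  qed
  then show ?thesis by (simp add: S_def S2_def U_def)
qed

subsection \<open>Coprime pairs of polynomials\<close>

lemma poly_bezout:
  fixes x y :: "'a::field poly"
  shows "\<exists>g a b. g = a * x + b * y \<and> g dvd x \<and> g dvd y"
\<comment> \<open>The Euclidean algorithm. The measure has to separate y = 0 from the non-zero
  constants, whose degree is 0 as well.\<close>
proof (induction "if y = 0 then 0 else Suc (degree y)" arbitrary: x y rule: less_induct)
  case less
  show ?case
  proof (cases "y = 0")
    case True
    then show ?thesis by (intro exI[of _ x] exI[of _ 1] exI[of _ 0]) simp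
  next
    case False
    then have "x mod y = 0 \<or> degree (x mod y) < degree y" by (rule degree_mod_less)
    then have "\<exists>g a b. g = a * y + b * (x mod y) \<and> g dvd y \<and> g dvd x mod y"
      using False by (intro less) auto
    then obtain g a b where g: "g = a * y + b * (x mod y)" "g dvd y" "g dvd x mod y" by blast
    have "x mod y = x - x div y * y" by (simp add: minus_div_mult_eq_mod)
    with g(1) have "g = b * x + (a - b * (x div y)) * y" by (simp add: algebra_simps)
    moreover have "g dvd x" using g(2,3) by (simp add: dvd_mod_iff)
    ultimately show ?thesis using g(2) by blast
  qed
qed

definition comaximal :: "'a::comm_ring_1 \<Rightarrow> 'a \<Rightarrow> bool" where
  "comaximal x y \<longleftrightarrow> (\<exists>a b. a * x + b * y = 1)"

lemma comaximal_dvd_mult: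
  assumes "comaximal x y" "y dvd z * x"
  shows "y dvd z"
proof -
  from assms(1) obtain a b where "a * x + b * y = 1" unfolding comaximal_def by blast
  then have "z = z * (a * x + b * y)" by simp
  then have z: "z = a * (z * x) + z * b * y" by (simp add: algebra_simps)
  show ?thesis
    by (subst z) (intro dvd_add dvd_mult assms(2) dvd_refl)
qed

text \<open>The leading coefficient 1 selects one polynomial from each class of associates, so that
  mutual divisibility means equality (\<open>monics_dvd_antisym\<close>).\<close>

definition monics :: "nat \<Rightarrow> 'a::{field,finite} poly set" where
  "monics j = {p. degree p = j \<and> lead_coeff p = 1}"

lemma monics_eq: "monics j = (\<lambda>r. monom 1 j + r) ` polys_below j"
proof (intro equalityI subsetI)
  fix p :: "'a poly" assume "p \<in> monics j"
  then have "p - monom 1 j \<in> polys_below j"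
    by (auto simp: monics_def polys_below_def coeff_eq_0)
  then show "p \<in> (\<lambda>r. monom 1 j + r) ` polys_below j"
    by (intro image_eqI[of _ _ "p - monom 1 j"]) auto
next
  fix p :: "'a poly" assume "p \<in> (\<lambda>r. monom 1 j + r) ` polys_below j"
  then have c: "coeff p j = 1" "\<And>i. i > j \<Longrightarrow> coeff p i = 0"
    by (auto simp: polys_below_def)
  then have "degree p = j"
    by (intro antisym degree_le le_degree) auto
  then show "p \<in> monics j" using c by (simp add: monics_def)
qed

lemma finite_monics [simp]: "finite (monics j)"
  by (simp add: monics_eq)

lemma card_monics: "card (monics j :: 'a::{field,finite} poly set) = CARD('a) ^ j"
  unfolding monics_eq by (subst card_image) (auto simp: inj_on_def card_polys_below)

lemma monics_nonzero: "p \<in> monics j \<Longrightarrow> p \<noteq> 0"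
  by (auto simp: monics_def)

lemma monics_dvd_antisym:
  assumes "p \<in> monics i" "q \<in> monics j" "p dvd q" "q dvd p"
  shows "p = q"
proof -
  obtain u v where u: "q = p * u" "p = q * v" using assms(3,4) unfolding dvd_def by blast
  have "p * (u * v) = p * 1" using u by (metis mult.assoc mult.right_neutral)
  then have "u * v = 1" using monics_nonzero[OF assms(1)] by (metis mult_left_cancel)
  then have "degree u = 0"
    by (metis is_unit_iff_degree dvdI mult_zero_left one_neq_zero)
  then obtain c where c: "u = [:c:]" by (metis degree_eq_zeroE)
  have "lead_coeff q = lead_coeff p * lead_coeff u" by (simp add: u(1) lead_coeff_mult)
  then have "c = 1" using assms(1,2) by (auto simp: monics_def c)
  then show ?thesis using u(1) c by simp
qed

lemma not_comaximal_divisor: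
  fixes x y :: "'a::{field,finite} poly"
  assumes "\<not> comaximal x y" "y \<noteq> 0"
  obtains d where "d \<in> monics (degree d)" "degree d \<ge> 1" "d dvd x" "d dvd y"
proof -
  obtain g a b where g: "g = a * x + b * y" "g dvd x" "g dvd y" using poly_bezout by blast
  have "g \<noteq> 0" using g(3) assms(2) by auto
  define d where "d = smult (inverse (lead_coeff g)) g"
  have d: "d \<in> monics (degree d)" "d dvd x" "d dvd y"
    using g(2,3) \<open>g \<noteq> 0\<close> by (auto simp: d_def monics_def smult_dvd_iff)
  have "degree d \<ge> 1"
  proof (rule ccontr)
    assume "\<not> degree d \<ge> 1"
    then have "degree d = 0" by simp
    then obtain c where "d = [:c:]" by (metis degree_eq_zeroE)
    with d(1) have "d = 1" by (auto simp: monics_def)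
    then have "smult (inverse (lead_coeff g)) a * x + smult (inverse (lead_coeff g)) b * y = 1"
      unfolding d_def g(1) by (simp add: smult_add_right)
    then show False using assms(1) unfolding comaximal_def by blast
  qed
  with d show ?thesis using that by blast
qed

lemma card_multiples_le:
  fixes d :: "'a::{field,finite} poly"
  assumes "d \<in> monics i" "i \<le> j"
  shows "card {x \<in> polys_below j. d dvd x} \<le> CARD('a) ^ (j - i)"
    and "card {y \<in> monics j. d dvd y} \<le> CARD('a) ^ (j - i)"
proof -
  have d: "d \<noteq> 0" "degree d = i" "lead_coeff d = 1"
    using assms(1) by (auto simp: monics_def)
  have "{x \<in> polys_below j. d dvd x} \<subseteq> (\<lambda>z. d * z) ` polys_below (j - i)"
  proof
    fix x assume "x \<in> {x \<in> polys_below j. d dvd x}"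
    then obtain z where z: "x = d * z" "d * z \<in> polys_below j" by (auto elim: dvdE)
    then have "z \<in> polys_below (j - i)"
      using d by (cases "z = 0") (auto simp: polys_below_iff degree_mult_eq)
    with z show "x \<in> (\<lambda>z. d * z) ` polys_below (j - i)" by blast
  qed
  then have "card {x \<in> polys_below j. d dvd x} \<le> card (polys_below (j - i) :: 'a poly set)"
    by (rule surj_card_le[rotated]) simp
  then show "card {x \<in> polys_below j. d dvd x} \<le> CARD('a) ^ (j - i)"
    by (simp add: card_polys_below)
  have "{y \<in> monics j. d dvd y} \<subseteq> (\<lambda>z. d * z) ` monics (j - i)"
  proof
    fix x assume "x \<in> {x \<in> monics j. d dvd x}"
    then obtain z where z: "x = d * z" "d * z \<in> monics j" by (auto elim: dvdE)
    then have "z \<noteq> 0" by (auto simp: monics_def)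
    then have "z \<in> monics (j - i)"
      using z(2) d by (auto simp: monics_def degree_mult_eq coeff_mult_degree_sum)
    with z show "x \<in> (\<lambda>z. d * z) ` monics (j - i)" by blast
  qed
  then have "card {x \<in> monics j. d dvd x} \<le> card (monics (j - i) :: 'a poly set)"
    by (rule surj_card_le[rotated]) simp
  then show "card {x \<in> monics j. d dvd x} \<le> CARD('a) ^ (j - i)"
    by (simp add: card_monics)
qed

text \<open>Removing the constant coefficient c, which is non-zero, leaves a monic polynomial of
  degree i. The factor s - 1 in place of s is the saving that keeps the union bound in
  \<open>sum_coprime_count\<close> below the total number of pairs.\<close>

lemma card_monics_not_X_dvd:
  "card {d \<in> monics (Suc i). coeff d 0 \<noteq> (0::'a::{field,finite})} \<le> (CARD('a) - 1) * CARD('a) ^ i"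
proof -
  have "{d \<in> monics (Suc i). coeff d 0 \<noteq> 0}
      \<subseteq> (\<lambda>(c, e). pCons c e) ` ((UNIV - {0 :: 'a}) \<times> (monics i :: 'a poly set))"
  proof
    fix d :: "'a poly" assume d: "d \<in> {d \<in> monics (Suc i). coeff d 0 \<noteq> 0}"
    obtain c e where ce: "d = pCons c e" by (cases d)
    have "e \<noteq> 0" using d by (auto simp: ce monics_def)
    then have "c \<noteq> 0" "e \<in> monics i" using d by (auto simp: ce monics_def)
    then show "d \<in> (\<lambda>(c, e). pCons c e) ` ((UNIV - {0}) \<times> monics i)"
      using ce by auto
  qed
  then have "card {d \<in> monics (Suc i). coeff d 0 \<noteq> (0::'a)}
      \<le> card ((UNIV - {0 :: 'a}) \<times> (monics i :: 'a poly set))"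
    by (rule surj_card_le[rotated]) simp
  also have "\<dots> = (CARD('a) - 1) * CARD('a) ^ i"
    by (simp add: card_cartesian_product card_monics card_Diff_singleton)
  finally show ?thesis .
qed

text \<open>The i-th term bounds the pairs with a common divisor of degree i + 1 prime to X: at most
  (s - 1) s^i divisors, each dividing at most s^(j-i-1) polynomials on either side. Passing from j
  to j + 1 multiplies the old terms by s^2 and adds (s - 1) s^j, which gives the exact value (s^(2j)
  - s^j) / s.\<close>

lemma geometric_sum_bound:
  "(\<Sum>i<j. (s - 1) * s ^ i * (s ^ (j - Suc i))\<^sup>2) \<le> s ^ (2 * j) / s" if "s \<ge> 1" for s :: real
proof -
  have "(\<Sum>i<j. (s - 1) * s ^ i * (s ^ (j - Suc i))\<^sup>2) = (s ^ (2 * j) - s ^ j) / s"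
  proof (induction j)
    case (Suc j)
    have "(\<Sum>i<Suc j. (s - 1) * s ^ i * (s ^ (Suc j - Suc i))\<^sup>2)
        = (\<Sum>i<j. s\<^sup>2 * ((s - 1) * s ^ i * (s ^ (j - Suc i))\<^sup>2)) + (s - 1) * s ^ j"
    proof -
      have "s ^ (Suc j - Suc i) = s * s ^ (j - Suc i)" if "i < j" for i
        using that by (metis Suc_diff_Suc diff_Suc_Suc power_Suc)
      then show ?thesis by (simp add: power_mult_distrib mult_ac)
    qed
    also have "\<dots> = (s ^ (2 * Suc j) - s ^ Suc j) / s"
      unfolding sum_distrib_left[symmetric] Suc.IH using that
      by (simp add: field_simps power2_eq_square)
    finally show ?case .
  qed simp
  also have "\<dots> \<le> s ^ (2 * j) / s" using that by (simp add: divide_right_mono)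
  finally show ?thesis .
qed

text \<open>For y of degree j this is Euler's totient of y, as the polynomials of degree below j
  represent the residues modulo y.\<close>

definition coprime_count :: "nat \<Rightarrow> 'a::{field,finite} poly \<Rightarrow> nat" where
  "coprime_count j y = card {x \<in> polys_below j. comaximal x y}"

text \<open>A pair that is not coprime has the common divisor X or a monic common divisor prime to
  X. These pairs make up at most the proportions 1/s^2 and 1/s of all s^(2j) pairs, together at most
  3/4 because s >= 2.\<close>

lemma sum_coprime_count:
  "(\<Sum>y\<in>monics j. real (coprime_count j (y :: 'a poly))) \<ge> real CARD('a::{field,finite}) ^ (2 * j) / 4"
proof (cases "j = 0")
  case True
  have "monics 0 = {1 :: 'a poly}"
    by (auto simp: monics_def elim: degree_eq_zeroE)
  moreover have "comaximal 0 (1 :: 'a poly)" by (auto simp: comaximal_def)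
  then have "{x. x = 0 \<and> comaximal x (1 :: 'a poly)} = {0}" by auto
  ultimately show ?thesis using True by (simp add: coprime_count_def)
next
  case False
  define s where "s = real CARD('a)"
  have s: "s \<ge> 2" using card_gt_1[where 'a='a] by (simp add: s_def)
  define X :: "'a poly" where "X = [:0, 1:]"
  define D where "D = (\<lambda>i. {d :: 'a poly. d \<in> monics (Suc i) \<and> coeff d 0 \<noteq> 0})"
  define M where "M = (\<lambda>d :: 'a poly. {x \<in> polys_below j. d dvd x} \<times> {y \<in> monics j. d dvd y})"
  define B where "B = {(x, y) \<in> polys_below j \<times> monics j. \<not> comaximal x (y :: 'a poly)}"
  define G where "G = {(x, y) \<in> polys_below j \<times> monics j. comaximal x (y :: 'a poly)}"
  have finM: "finite (M d)" for d by (simp add: M_def)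
  have finD: "finite (D i)" for i by (simp add: D_def)
  have cardM: "real (card (M d)) \<le> (s ^ (j - i))\<^sup>2" if "d \<in> monics i" "i \<le> j" for d i
  proof -
    have "card (M d) \<le> CARD('a) ^ (j - i) * CARD('a) ^ (j - i)"
      unfolding M_def card_cartesian_product
      by (intro mult_le_mono card_multiples_le that)
    then have "real (card (M d)) \<le> real (CARD('a) ^ (j - i) * CARD('a) ^ (j - i))"
      by (rule of_nat_mono)
    then show ?thesis by (simp add: s_def power2_eq_square)
  qed
  \<comment> \<open>A union bound over all monic common divisors would be useless for \<open>s = 2\<close>. It suffices
    to consider \<open>X\<close> and the divisors prime to \<open>X\<close>.\<close>
  have "B \<subseteq> M X \<union> (\<Union>i<j. \<Union>d\<in>D i. M d)"
  proof clarify
    fix x y assume xy: "(x, y) \<in> B" "(x, y) \<notin> (\<Union>i<j. \<Union>d\<in>D i. M d)"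
    then have x: "x \<in> polys_below j" and y: "y \<in> monics j" "y \<noteq> 0" and "\<not> comaximal x y"
      by (auto simp: B_def dest: monics_nonzero)
    then obtain d where d: "d \<in> monics (degree d)" "degree d \<ge> 1" "d dvd x" "d dvd y"
      using not_comaximal_divisor by blast
    have "degree d \<le> j" using dvd_imp_degree_le[OF d(4) y(2)] y(1) by (simp add: monics_def)
    with d(2) obtain i where i: "degree d = Suc i" "i < j" by (cases "degree d") auto
    have "coeff d 0 = 0"
    proof (rule ccontr)
      assume "coeff d 0 \<noteq> 0"
      then have "d \<in> D i" using d(1) i by (simp add: D_def)
      moreover have "(x, y) \<in> M d" using x y d by (simp add: M_def)
      ultimately show False using xy(2) i by blast
    qed
    then have "X dvd d" by (simp add: X_def dvd_iff_poly_eq_0 poly_0_coeff_0)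
    then show "(x, y) \<in> M X" using x y d dvd_trans by (auto simp: M_def)
  qed
  then have "card B \<le> card (M X \<union> (\<Union>i<j. \<Union>d\<in>D i. M d))"
    by (intro card_mono) (auto intro: finM finD)
  also have "\<dots> \<le> card (M X) + (\<Sum>i<j. \<Sum>d\<in>D i. card (M d))"
    by (intro order_trans[OF card_Un_le] add_left_mono order_trans[OF card_UN_le] sum_mono
        card_UN_le finD) auto
  finally have "real (card B) \<le> real (card (M X) + (\<Sum>i<j. \<Sum>d\<in>D i. card (M d)))"
    by (rule of_nat_mono)
  also have "\<dots> \<le> (s ^ (j - 1))\<^sup>2 + (\<Sum>i<j. (s - 1) * s ^ i * (s ^ (j - Suc i))\<^sup>2)"
  proof -
    have "X \<in> monics 1" by (simp add: X_def monics_def)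
    then have 1: "real (card (M X)) \<le> (s ^ (j - 1))\<^sup>2" using False by (intro cardM) auto
    have 2: "(\<Sum>d\<in>D i. real (card (M d))) \<le> (s - 1) * s ^ i * (s ^ (j - Suc i))\<^sup>2" if "i < j" for i
    proof -
      have "(\<Sum>d\<in>D i. real (card (M d))) \<le> (\<Sum>d\<in>D i. (s ^ (j - Suc i))\<^sup>2)"
        using that by (intro sum_mono cardM) (auto simp: D_def)
      also have "\<dots> = real (card (D i)) * (s ^ (j - Suc i))\<^sup>2" by simp
      also have "\<dots> \<le> real ((CARD('a) - 1) * CARD('a) ^ i) * (s ^ (j - Suc i))\<^sup>2"
        unfolding D_def by (intro mult_right_mono of_nat_mono card_monics_not_X_dvd) auto
      also have "\<dots> = (s - 1) * s ^ i * (s ^ (j - Suc i))\<^sup>2"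
        by (simp add: s_def of_nat_diff Suc_le_eq)
      finally show ?thesis .
    qed
    have "(\<Sum>i<j. \<Sum>d\<in>D i. real (card (M d))) \<le> (\<Sum>i<j. (s - 1) * s ^ i * (s ^ (j - Suc i))\<^sup>2)"
      by (intro sum_mono 2) simp
    with 1 show ?thesis by simp
  qed
  also have "\<dots> \<le> s ^ (2 * j) / s\<^sup>2 + s ^ (2 * j) / s"
  proof (intro add_mono geometric_sum_bound)
    have "s ^ (j - 1) * s = s ^ j" using False by (cases j) auto
    then have "(s ^ (j - 1))\<^sup>2 * s\<^sup>2 = s ^ (2 * j)"
      by (simp add: power_even_eq flip: power_mult_distrib)
    then show "(s ^ (j - 1))\<^sup>2 \<le> s ^ (2 * j) / s\<^sup>2" using s by (simp add: field_simps)
  qed (use s in auto)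
  also have "\<dots> \<le> s ^ (2 * j) / 4 + s ^ (2 * j) / 2"
    using s power_mono[of 2 s 2] by (intro add_mono divide_left_mono) auto
  finally have B: "real (card B) \<le> 3 / 4 * s ^ (2 * j)" by simp
  have fin: "finite B" "finite G" 
    by (rule finite_subset[of _ "polys_below j \<times> monics j"]; auto simp: B_def G_def)+
  have "real (card G) + real (card B) = real (card (G \<union> B))"
    using fin by (subst card_Un_disjoint) (auto simp: B_def G_def)
  also have "G \<union> B = polys_below j \<times> monics j" by (auto simp: B_def G_def)
  also have "real (card \<dots>) = s ^ (2 * j)"
    by (simp add: card_cartesian_product card_polys_below card_monics s_def mult_2 power_add)
  finally have "real (card G) \<ge> s ^ (2 * j) / 4" using B by simp
  moreover have "card G = (\<Sum>y\<in>monics j. coprime_count j (y :: 'a poly))"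
  proof -
    have "G = (\<lambda>(y, x). (x, y)) ` (SIGMA y:monics j. {x \<in> polys_below j. comaximal x y})"
      by (auto simp: G_def image_iff)
    then have "card G = card (SIGMA y:monics j. {x \<in> polys_below j. comaximal x (y :: 'a poly)})"
      by (simp add: card_image inj_on_def split_beta)
    then show ?thesis by (simp add: coprime_count_def)
  qed
  ultimately show ?thesis by (simp add: s_def)
qed

lemma finite_card_vec:
  fixes F :: "'n::finite \<Rightarrow> 'b set"
  assumes "\<And>i. finite (F i)"
  shows "finite {v :: 'b ^ 'n. \<forall>i. v $ i \<in> F i} \<and>
    card {v :: 'b ^ 'n. \<forall>i. v $ i \<in> F i} = (\<Prod>i\<in>UNIV. card (F i))"
proof -
  have "bij_betw vec_lambda (PiE UNIV F) {v :: 'b ^ 'n. \<forall>i. v $ i \<in> F i}"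
    by (rule bij_betwI[where g=vec_nth]) auto
  moreover have "finite (PiE UNIV F)" "card (PiE UNIV F) = (\<Prod>i\<in>UNIV. card (F i))"
    using assms by (auto intro: finite_PiE simp: card_PiE)
  ultimately show ?thesis using bij_betw_finite bij_betw_same_card by fastforce
qed

subsection \<open>Quasi-independence of the approximation events\<close>

lemma prod_if_eq:
  fixes a b :: "'b::comm_monoid_mult"
  shows "(\<Prod>i\<in>(UNIV :: 'n::finite set). if i = i0 then a else b) = a * b ^ (CARD('n) - 1)"
proof -
  have "(\<Prod>i\<in>UNIV - {i0}. if i = i0 then a else b) = (\<Prod>i\<in>UNIV - {i0}. b)"
    by (rule prod.cong) auto
  then show ?thesis by (subst prod.remove[of _ i0]) (auto simp: card_Diff_singleton)
qed

lemma cramer_two: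
  fixes a b c d y z :: "'b::field"
  assumes "a * d - b * c \<noteq> 0"
  shows "(y * d - z * b) / (a * d - b * c) * a + (z * a - y * c) / (a * d - b * c) * b = y"
    and "(y * d - z * b) / (a * d - b * c) * c + (z * a - y * c) / (a * d - b * c) * d = z"
  using assms by (simp_all add: add_divide_distrib[symmetric] divide_eq_eq) (simp_all add: algebra_simps)

text \<open>Write y = g u and y' = g u' with u, u' comaximal. The value u' x - u x' has degree below
  N - deg g and determines x modulo u; the quotient x div u has degree below j - deg u = deg g. Both
  together determine x and then x', and deg g cancels from the count.\<close>

lemma card_close_pairs_le:
  fixes y y' g :: "'a::{field,finite} poly"
  assumes y: "degree y = j" "y \<noteq> 0"
    and g: "g = a * y + b * y'" "g dvd y" "g dvd y'" "degree g < N"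
  shows "card {(x, x') \<in> polys_below j \<times> polys_below j'. y' * x - y * x' \<in> polys_below N} \<le> CARD('a) ^ N"
proof -
  define S where "S = {(x, x') \<in> polys_below j \<times> polys_below j'. y' * x - y * x' \<in> polys_below N}"
  obtain u u' where u: "y = g * u" "y' = g * u'" using g(2,3) unfolding dvd_def by blast
  have nz: "g \<noteq> 0" "u \<noteq> 0" using y(2) u(1) by auto
  have "g * (a * u + b * u') = g * 1" using g(1) by (simp add: u algebra_simps)
  then have "a * u + b * u' = 1" using nz(1) by (metis mult_left_cancel)
  then have cop: "comaximal u' u" unfolding comaximal_def by (metis add.commute)
  have j: "j = degree g + degree u" using y(1) u(1) nz by (simp add: degree_mult_eq)
  have below: "z \<in> polys_below (n - degree w)" if "w * z \<in> polys_below n" "w \<noteq> 0" for w z n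
    using that by (cases "z = 0") (auto simp: polys_below_iff degree_mult_eq)
  define \<phi> where "\<phi> = (\<lambda>(x, x'). (u' * x - u * x', x div u))"
  have "inj_on \<phi> S"
  proof (rule inj_onI, clarify)
    fix x x' z z' assume "\<phi> (x, x') = \<phi> (z, z')"
    then have eq: "u' * x - u * x' = u' * z - u * z'" "x div u = z div u"
      by (auto simp: \<phi>_def)
    have eq': "(x - z) * u' = u * (x' - z')" using eq(1) by (simp add: algebra_simps)
    then have "u dvd x - z" using comaximal_dvd_mult[OF cop] by (metis dvd_triv_left)
    then have "x mod u = z mod u" by (simp add: mod_eq_dvd_iff)
    with eq(2) have xz: "x = z" by (metis div_mult_mod_eq)
    with eq' nz show "x = z \<and> x' = z'" by simp
  qed
  moreover have "\<phi> ` S \<subseteq> polys_below (N - degree g) \<times> polys_below (degree g)"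
  proof (rule image_subsetI)
    fix z assume "z \<in> S"
    moreover obtain x x' where z: "z = (x, x')" by force
    ultimately have "(x, x') \<in> S" by simp
    then have x: "x \<in> polys_below j" "g * (u' * x - u * x') \<in> polys_below N"
      by (auto simp: S_def u algebra_simps)
    have "x mod u = 0 \<or> degree (x mod u) < degree u" using nz(2) by (rule degree_mod_less)
    then have "x mod u \<in> polys_below j" using j by (auto simp: polys_below_iff)
    then have "u * (x div u) \<in> polys_below j"
      using polys_below_diff[OF x(1)] by (metis minus_mod_eq_mult_div)
    then show "\<phi> z \<in> polys_below (N - degree g) \<times> polys_below (degree g)"
      using below[of u "x div u" j] below[OF x(2) nz(1)] nz(2) j by (simp add: \<phi>_def z)
  qed
  ultimately have "card S \<le> card (polys_below (N - degree g) \<times> polys_below (degree g) :: ('a poly \<times> 'a poly) set)"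
    by (rule card_inj_on_le) simp
  also have "\<dots> = CARD('a) ^ N"
    using g(4) by (simp add: card_cartesian_product card_polys_below flip: power_add)
  finally show ?thesis by (simp add: S_def)
qed

text \<open>The top degree j is attained at k0 only, by a monic entry. These s^(jn) vectors are a
  fixed proportion of all vectors of degree j, and two parallel ones with the same entry at k0
  coincide.\<close>

definition denominators :: "'n \<Rightarrow> nat \<Rightarrow> ('a::{field,finite} poly ^ 'n) set" where
  "denominators k0 j = {q. \<forall>k. q $ k \<in> (if k = k0 then monics j else polys_below j)}"

text \<open>Coprimality in a single coordinate already ensures that approximations \<open>(p, q)\<close> and
  \<open>(p', q')\<close> with \<open>q \<noteq> q'\<close> parallel are not proportional.\<close>

definition numerators :: "'m \<Rightarrow> nat \<Rightarrow> 'a::{field,finite} poly \<Rightarrow> ('a poly ^ 'm) set" where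
  "numerators i0 j y = {p. \<forall>i. p $ i \<in> (if i = i0 then {x \<in> polys_below j. comaximal x y} else polys_below j)}"

lemma finite_denominators [simp]: "finite (denominators k0 j)"
  unfolding denominators_def by (rule finite_card_vec[THEN conjunct1]) auto

lemma denominators_k0: "q \<in> denominators k0 j \<Longrightarrow> q $ k0 \<in> monics j"
  by (auto simp: denominators_def dest: spec[of _ k0])

lemma finite_numerators [simp]: "finite (numerators i0 j y)"
  unfolding numerators_def by (rule finite_card_vec[THEN conjunct1]) auto

lemma card_numerators:
  "card (numerators i0 j y :: ('a::{field,finite} poly ^ 'm) set) =
    coprime_count j y * (CARD('a) ^ j) ^ (CARD('m) - 1)"
proof -
  have "card (numerators i0 j y :: ('a poly ^ 'm) set) =
    (\<Prod>i\<in>UNIV. card (if i = i0 then {x \<in> polys_below j. comaximal x y} else polys_below j))"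
    unfolding numerators_def by (rule finite_card_vec[THEN conjunct2]) auto
  then show ?thesis
    by (simp add: if_distrib[of card] prod_if_eq card_polys_below coprime_count_def)
qed

lemma card_denominators_fixed:
  assumes "y \<in> monics j"
  shows "card {q \<in> denominators k0 j :: ('a::{field,finite} poly ^ 'n) set. q $ k0 = y} =
    (CARD('a) ^ j) ^ (CARD('n) - 1)"
proof -
  have "{q \<in> denominators k0 j :: ('a poly ^ 'n) set. q $ k0 = y} =
    {q. \<forall>k. q $ k \<in> (if k = k0 then {y} else polys_below j)}"
    using assms by (auto simp: denominators_def)
  also have "card \<dots> = (\<Prod>k\<in>UNIV. card (if k = k0 then {y} else polys_below j))"
    by (rule finite_card_vec[THEN conjunct2]) auto
  finally show ?thesis
    by (simp add: if_distrib[of card] prod_if_eq card_polys_below)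
qed

lemma sum_denominators:
  fixes h :: "'a::{field,finite} poly \<Rightarrow> real"
  shows "(\<Sum>q\<in>(denominators k0 j :: ('a poly ^ 'n) set). h (q $ k0)) =
    (real CARD('a) ^ j) ^ (CARD('n) - 1) * (\<Sum>y\<in>monics j. h y)"
proof -
  have "(\<Sum>q\<in>(denominators k0 j :: ('a poly ^ 'n) set). h (q $ k0)) =
    (\<Sum>y\<in>monics j. \<Sum>q\<in>{q \<in> denominators k0 j :: ('a poly ^ 'n) set. q $ k0 = y}. h (q $ k0))"
    by (rule sum.group[symmetric]) (auto dest: denominators_k0)
  also have "\<dots> = (\<Sum>y\<in>monics j. (real CARD('a) ^ j) ^ (CARD('n) - 1) * h y)"
    by (rule sum.cong) (simp_all add: card_denominators_fixed)
  finally show ?thesis by (simp add: sum_distrib_left)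
qed

lemma card_denominators:
  "real (card (denominators k0 j :: ('a::{field,finite} poly ^ 'n) set)) =
    real CARD('a) ^ (j * CARD('n))"
proof -
  have "real (card (denominators k0 j :: ('a poly ^ 'n) set)) =
      (real CARD('a) ^ j) ^ (CARD('n) - 1) * real CARD('a) ^ j"
    using sum_denominators[of "\<lambda>_ :: 'a poly. 1" k0 j] by (simp add: card_monics)
  also have "\<dots> = (real CARD('a) ^ j) ^ CARD('n)"
    by (metis One_nat_def Suc_pred mult.commute power_Suc zero_less_card_finite)
  finally show ?thesis by (simp add: power_mult)
qed

lemma denominators_below: "q \<in> denominators k0 j \<Longrightarrow> q $ k \<in> polys_below (Suc j)"
  by (auto simp: denominators_def polys_below_iff monics_def split: if_splits dest: spec[of _ k])

lemma numerators_below: "p \<in> numerators i0 j y \<Longrightarrow> p $ i \<in> polys_below j"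
  by (auto simp: numerators_def split: if_splits dest: spec[of _ i])

lemma numerators_comaximal: "p \<in> numerators i0 j y \<Longrightarrow> comaximal (p $ i0) y"
  by (auto simp: numerators_def dest: spec[of _ i0])

context haar_matrices
begin

lemma prob_near_integer_vector_le:
  fixes q :: "'a poly ^ 'n"
  assumes "q \<noteq> 0" "l \<ge> 1"
  shows "prob {A \<in> mball 0. \<exists>p. vec_to_k p + A *v vec_to_k q \<in> vball (int l)}
    \<le> 1 / real CARD('a) ^ ((l - 1) * CARD('m))"
proof -
  obtain k where k: "q $ k \<noteq> 0" using assms(1) by (metis vec_eq_iff zero_index)
  define f where "f = (\<lambda>(A :: 'a fls ^ 'n ^ 'm) i. (A *v vec_to_k q) $ i)"
  have "prob {A \<in> mball 0. \<forall>i. \<exists>p. f A i + poly_to_k p \<in> fball (int l)}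
    \<le> (\<Prod>i\<in>(UNIV :: 'm set). 1 / real CARD('a) ^ (l - 1))"
  proof (rule prob_near_integers_le)
    show "f (A + B) d = f A d + f B d" for A B d
      by (simp add: f_def matrix_vector_mult_add_rdistrib)
    show "\<exists>p. f (poly_matrix C) d = poly_to_k p" for C d
      by (simp add: f_def poly_matrix_mult) (simp add: vec_to_k_def)
    show "\<exists>B. \<forall>d. f B d = y d" for y
      using k by (intro exI[of _ "\<chi> i j. if j = k then y i / poly_to_k (q $ k) else 0"])
        (simp add: f_def matrix_vector_mult_def vec_to_k_def if_distrib if_distribR cong: if_cong)
    show "\<exists>t. \<forall>A\<in>mball t. \<forall>d. f A d \<in> fball (int l)"
      using stable_vball_mult[of "vec_to_k q" "int l"] by (simp add: f_def vball_def)
  qed (use assms in auto)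
  moreover have "{A \<in> mball 0. \<exists>p. vec_to_k p + A *v vec_to_k q \<in> vball (int l)} =
    {A \<in> mball 0. \<forall>i. \<exists>p. f A i + poly_to_k p \<in> fball (int l)}"
  proof -
    have "(\<exists>p. vec_to_k p + A *v vec_to_k q \<in> vball (int l)) \<longleftrightarrow>
      (\<forall>i. \<exists>p. f A i + poly_to_k p \<in> fball (int l))" for A
    proof
      assume "\<forall>i. \<exists>p. f A i + poly_to_k p \<in> fball (int l)"
      then obtain p where "\<And>i. f A i + poly_to_k (p i) \<in> fball (int l)" by metis
      then show "\<exists>p. vec_to_k p + A *v vec_to_k q \<in> vball (int l)"
        by (intro exI[of _ "\<chi> i. p i"]) (simp add: f_def vball_def vec_to_k_def add.commute)
    qed (auto simp: f_def vball_def vec_to_k_def add.commute)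
    then show ?thesis by blast
  qed
  ultimately show ?thesis by (simp add: power_mult power_one_over)
qed

text \<open>The 2m coordinates of A q and A q' can be prescribed freely: for each row of A, its
  entries in the columns k0 and k solve a linear system with determinant \<open>\<Delta>\<close>. So
  \<open>prob_near_integers_le\<close> applies with pairs of a row and a Boolean as indices, the
  Boolean choosing between q and q'.\<close>

lemma prob_pair_independent:
  fixes q q' :: "'a poly ^ 'n"
  assumes det: "q $ k0 * q' $ k \<noteq> q $ k * q' $ k0" and l: "l \<ge> 1" "l' \<ge> 1"
  shows "prob {A \<in> mball 0. (\<exists>p. vec_to_k p + A *v vec_to_k q \<in> vball (int l)) \<and>
      (\<exists>p. vec_to_k p + A *v vec_to_k q' \<in> vball (int l'))}
    \<le> 1 / (real CARD('a) ^ ((l - 1) * CARD('m)) * real CARD('a) ^ ((l' - 1) * CARD('m)))"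
proof -
  define f where "f = (\<lambda>(A :: 'a fls ^ 'n ^ 'm) (i, b). (A *v vec_to_k (if b then q else q')) $ i)"
  define L where "L = (\<lambda>(i :: 'm, b). if b then l else l')"
  define \<Delta> where "\<Delta> = poly_to_k (q $ k0) * poly_to_k (q' $ k) - poly_to_k (q $ k) * poly_to_k (q' $ k0)"
  have "\<Delta> \<noteq> 0" using det by (simp add: \<Delta>_def flip: poly_to_k_mult)
  have "k \<noteq> k0" using det by auto
  have "prob {A \<in> mball 0. \<forall>d. \<exists>p. f A d + poly_to_k p \<in> fball (int (L d))}
    \<le> (\<Prod>d\<in>UNIV. 1 / real CARD('a) ^ (L d - 1))"
  proof (rule prob_near_integers_le)
    show "f (A + B) d = f A d + f B d" for A B d
      by (cases d) (simp add: f_def matrix_vector_mult_add_rdistrib)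
    show "\<exists>p. f (poly_matrix C) d = poly_to_k p" for C d
      by (cases d) (simp add: f_def poly_matrix_mult, simp add: vec_to_k_def)
    show "\<exists>B. \<forall>d. f B d = y d" for y
    proof -
      define B :: "'a fls ^ 'n ^ 'm" where "B = (\<chi> i j.
        if j = k0 then (y (i, True) * poly_to_k (q' $ k) - y (i, False) * poly_to_k (q $ k)) / \<Delta>
        else if j = k then (y (i, False) * poly_to_k (q $ k0) - y (i, True) * poly_to_k (q' $ k0)) / \<Delta>
        else 0)"
      have Bv: "(B *v v) $ i = (B $ i $ k0) * v $ k0 + (B $ i $ k) * v $ k" for v i
      proof -
        have "(B *v v) $ i = (\<Sum>j\<in>UNIV. B $ i $ j * v $ j)" by (simp add: matrix_vector_mult_def)
        also have "\<dots> = (\<Sum>j\<in>{k0, k}. B $ i $ j * v $ j)"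
          by (rule sum.mono_neutral_right) (auto simp: B_def)
        finally show ?thesis using \<open>k \<noteq> k0\<close> by simp
      qed
      have "f B (i, b) = y (i, b)" for i b
        using cramer_two[OF \<open>\<Delta> \<noteq> 0\<close>[unfolded \<Delta>_def], of "y (i, True)" "y (i, False)"] \<open>k \<noteq> k0\<close>
        unfolding f_def prod.case Bv by (cases b) (simp_all add: B_def vec_to_k_def \<Delta>_def)
      then show ?thesis by auto
    qed
    obtain t t' where t:
      "\<And>A :: 'a fls ^ 'n ^ 'm. A \<in> mball t \<Longrightarrow> A *v vec_to_k q \<in> vball (int l)"
      "\<And>A :: 'a fls ^ 'n ^ 'm. A \<in> mball t' \<Longrightarrow> A *v vec_to_k q' \<in> vball (int l')"
      using stable_vball_mult by metis
    show "\<exists>t. \<forall>A\<in>mball t. \<forall>d. f A d \<in> fball (int (L d))"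
    proof (intro exI[of _ "max t t'"] ballI allI)
      fix A :: "'a fls ^ 'n ^ 'm" and d assume A: "A \<in> mball (max t t')"
      have "A \<in> mball t" "A \<in> mball t'" by (auto intro: mball_mono[OF A])
      then show "f A d \<in> fball (int (L d))"
        using t by (cases d) (auto simp: f_def L_def vball_def)
    qed
  qed (use l in \<open>auto simp: L_def\<close>)
  also have "(\<Prod>d\<in>UNIV. 1 / real CARD('a) ^ (L d - 1)) =
    (\<Prod>i\<in>(UNIV :: 'm set). \<Prod>b\<in>UNIV. 1 / real CARD('a) ^ (L (i, b) - 1))"
    by (subst prod.cartesian_product) (simp add: UNIV_Times_UNIV split_def)
  also have "\<dots> = 1 / (real CARD('a) ^ ((l - 1) * CARD('m)) * real CARD('a) ^ ((l' - 1) * CARD('m)))"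
    by (simp add: L_def UNIV_bool power_divide power_mult_distrib mult.commute flip: power_mult)
  also have "{A \<in> mball 0. \<forall>d. \<exists>p. f A d + poly_to_k p \<in> fball (int (L d))} =
    {A \<in> mball 0. (\<exists>p. vec_to_k p + A *v vec_to_k q \<in> vball (int l)) \<and>
      (\<exists>p. vec_to_k p + A *v vec_to_k q' \<in> vball (int l'))}"
  proof -
    have "(\<exists>p. vec_to_k p + A *v vec_to_k r \<in> vball c) \<longleftrightarrow>
      (\<forall>i. \<exists>p. (A *v vec_to_k r) $ i + poly_to_k p \<in> fball c)"
      for A :: "'a fls ^ 'n ^ 'm" and r c
    proof
      assume "\<forall>i. \<exists>p. (A *v vec_to_k r) $ i + poly_to_k p \<in> fball c"
      then obtain p where "\<And>i. (A *v vec_to_k r) $ i + poly_to_k (p i) \<in> fball c" by metis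
      then show "\<exists>p. vec_to_k p + A *v vec_to_k r \<in> vball c"
        by (intro exI[of _ "\<chi> i. p i"]) (simp add: vball_def vec_to_k_def add.commute)
    qed (auto simp: vball_def vec_to_k_def add.commute)
    then show ?thesis by (auto simp: f_def L_def split_paired_All all_bool_eq)
  qed
  finally show ?thesis .
qed

definition approx_event where
  "approx_event i0 k0 j l q = {A \<in> mball 0. \<exists>p\<in>numerators i0 j ((q :: 'a poly ^ 'n) $ k0).
     vec_to_k p + A *v vec_to_k q \<in> vball (int l)}"

lemma approx_event_sets: "approx_event i0 k0 j l q \<in> events"
  unfolding approx_event_def by (intro event_sets stable_bex stable_affine) simp

text \<open>Two different integer vectors are never both within s^-l of -A q when l >= 1, so the
  conditions for different numerators exclude each other and the probabilities of
  \<open>prob_affine\<close> add up.\<close>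

lemma prob_approx_event:
  assumes q: "q \<in> denominators k0 j" and l: "l \<ge> 1"
  shows "prob (approx_event i0 k0 j l q) =
    real (coprime_count j (q $ k0)) * (real CARD('a) ^ j) ^ (CARD('m) - 1) / real CARD('a) ^ ((l + j) * CARD('m))"
proof -
  have "prob (approx_event i0 k0 j l q) =
    real (card (numerators i0 j (q $ k0) :: ('a poly ^ 'm) set)) * (1 / real CARD('a) ^ ((l + j) * CARD('m)))"
    unfolding approx_event_def
  proof (rule prob_equal_parts)
    fix p p' and A :: "'a fls ^ 'n ^ 'm"
    assume "vec_to_k p + A *v vec_to_k q \<in> vball (int l)" "vec_to_k p' + A *v vec_to_k q \<in> vball (int l)"
    then have "vec_to_k (p - p') \<in> vball (int l)"
      using vball_diff by (fastforce simp: vec_to_k_diff)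
    then have "vec_to_k (p - p') \<in> vball 1" using l by (auto intro: vball_mono)
    then have "(p - p') $ i = 0" for i
      by (simp add: vball_def vec_to_k_def poly_to_k_fball_1_iff del: vector_minus_component)
    then show "p = p'" by (simp add: vec_eq_iff)
  next
    fix p :: "'a poly ^ 'm" assume p: "p \<in> numerators i0 j (q $ k0)"
    have "p $ i \<in> polys_below (Suc j)" for i
      using numerators_below[OF p, of i] by (auto simp: polys_below_iff)
    then show "prob {A \<in> mball 0. vec_to_k p + A *v vec_to_k q \<in> vball (int l)} =
      1 / real CARD('a) ^ ((l + j) * CARD('m))"
      using denominators_k0[OF q] denominators_below[OF q]
      by (intro prob_affine) (auto simp: monics_def)
  qed (auto intro: stable_affine)
  then show ?thesis by (simp add: card_numerators)
qed

lemma sum_prob_approx_event: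
  assumes "l \<ge> 1"
  shows "(\<Sum>q\<in>denominators k0 j. prob (approx_event i0 k0 j l q)) \<ge>
    real CARD('a) ^ (j * CARD('n)) / real CARD('a) ^ (l * CARD('m)) / 4"
proof -
  define s where "s = real CARD('a)"
  have s: "s > 0" by (simp add: s_def)
  have m1: "x ^ CARD('m) = x * x ^ (CARD('m) - 1)" and n1: "x ^ CARD('n) = x * x ^ (CARD('n) - 1)" for x :: real
    by (metis One_nat_def Suc_pred power_Suc zero_less_card_finite)+
  have "s ^ (j * CARD('n)) / s ^ (l * CARD('m)) / 4 =
    (s ^ j) ^ (CARD('n) - 1) * (s ^ (2 * j) / 4 * ((s ^ j) ^ (CARD('m) - 1) / s ^ ((l + j) * CARD('m))))"
    using s by (simp add: power_mult n1 m1 add_mult_distrib power_add power2_eq_square field_simps)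
  also have "\<dots> \<le> (s ^ j) ^ (CARD('n) - 1) * ((\<Sum>y\<in>monics j. real (coprime_count j (y :: 'a poly))) *
      ((s ^ j) ^ (CARD('m) - 1) / s ^ ((l + j) * CARD('m))))"
    using sum_coprime_count[where j=j and 'a='a] s
    by (intro mult_left_mono mult_right_mono) (auto simp: s_def)
  also have "\<dots> = (\<Sum>q\<in>(denominators k0 j :: ('a poly ^ 'n) set).
      real (coprime_count j (q $ k0)) * ((s ^ j) ^ (CARD('m) - 1) / s ^ ((l + j) * CARD('m))))"
    by (subst sum_denominators) (simp only: s_def sum_distrib_right)
  also have "\<dots> = (\<Sum>q\<in>denominators k0 j. prob (approx_event i0 k0 j l q))"
    using assms by (intro sum.cong) (simp_all add: prob_approx_event s_def)
  finally show ?thesis by (simp add: s_def)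
qed

text \<open>The intersection is covered by the events \<open>E (p, p')\<close>, each of measure at
  most s^(-Tm). If such an event is non-empty, eliminating A shows that y' p - y p' has entries of
  degree below N, which leaves at most s^N choices per coordinate by
  \<open>card_close_pairs_le\<close>. Since N - T = 1 - l - l', the degrees j and j' drop out of the
  product.\<close>

lemma prob_pair_parallel:
  fixes q q' :: "'a poly ^ 'n"
  assumes q: "q \<in> denominators k0 j" "q' \<in> denominators k0 j'" "q \<noteq> q'" and l: "l \<ge> 1" "l' \<ge> 1"
    and par: "\<And>k. q $ k0 * q' $ k = q $ k * q' $ k0"
  shows "prob (approx_event i0 k0 j l q \<inter> approx_event i0 k0 j' l' q') \<le>
    real CARD('a) ^ CARD('m) / (real CARD('a) ^ (l * CARD('m)) * real CARD('a) ^ (l' * CARD('m)))"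
proof -
  define s where "s = real CARD('a)"
  have s: "s > 1" unfolding s_def by (rule card_gt_1)
  define y where "y = q $ k0"
  define y' where "y' = q' $ k0"
  have y: "y \<in> monics j" "y' \<in> monics j'"
    using q denominators_k0 by (auto simp: y_def y'_def)
  have deg: "degree y = j" "degree y' = j'" using y by (auto simp: monics_def)
  obtain g a b where g: "g = a * y + b * y'" "g dvd y" "g dvd y'" using poly_bezout by blast
  define T where "T = max (l + j) (l' + j')"
  \<comment> \<open>This is truncated subtraction. The final count needs N + l + l' = T + 1, which
    follows from deg g < N as soon as \<open>V\<close> is non-empty.\<close>
  define N where "N = T + 1 - (l + l')"
  define E where "E = (\<lambda>(p, p'). {A :: 'a fls ^ 'n ^ 'm. A \<in> mball 0 \<and> vec_to_k p + A *v vec_to_k q \<in> vball (int l) \<and>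
    vec_to_k p' + A *v vec_to_k q' \<in> vball (int l')})"
  define V where "V = {(p, p') \<in> numerators i0 j y \<times> numerators i0 j' y'. E (p, p') \<noteq> {}}"
  define S where "S = {(x, x') \<in> polys_below j \<times> polys_below j'. y' * x - y * x' \<in> polys_below N}"
  have "y \<noteq> y'"
  proof
    assume "y = y'"
    then have "q $ k = q' $ k" for k
      using par[of k] monics_nonzero[OF y(1)] by (simp add: y_def y'_def mult.commute)
    then show False using q(3) by (simp add: vec_eq_iff)
  qed
  have parv: "poly_to_k y' * (A *v vec_to_k q) $ i = poly_to_k y * (A *v vec_to_k q') $ i"
    for A :: "'a fls ^ 'n ^ 'm" and i
  proof -
    have "poly_to_k y' * poly_to_k (q $ k) = poly_to_k y * poly_to_k (q' $ k)" for k
      using par[of k] by (simp add: y_def y'_def mult.commute flip: poly_to_k_mult)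
    then have "poly_to_k y' * (A $ i $ k * poly_to_k (q $ k)) =
        poly_to_k y * (A $ i $ k * poly_to_k (q' $ k))" for k
      by (metis mult.left_commute)
    then have "(\<Sum>k\<in>UNIV. poly_to_k y' * (A $ i $ k * poly_to_k (q $ k))) =
        (\<Sum>k\<in>UNIV. poly_to_k y * (A $ i $ k * poly_to_k (q' $ k)))"
      by (intro sum.cong refl)
    then show ?thesis
      by (simp add: matrix_vector_mult_def vec_to_k_def sum_distrib_left)
  qed
  \<comment> \<open>As y' q = y q', the difference y' (p + A q) - y (p' + A q') no longer involves
    A. Its two terms have norms at most s^(j'-l) and s^(j-l'), and T is large enough for
    both.\<close>
  have close: "poly_to_k (y' * p $ i - y * p' $ i) \<in> fball (int (l + l') - int T)"
    if "A \<in> E (p, p')" for A and p p' :: "'a poly ^ 'm" and i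
  proof -
    have A: "(vec_to_k p + A *v vec_to_k q) $ i \<in> fball (int l)"
      "(vec_to_k p' + A *v vec_to_k q') $ i \<in> fball (int l')"
      using that by (auto simp: E_def vball_def)
    have "poly_to_k y' \<in> fball (- int j')" "poly_to_k y \<in> fball (- int j)"
      using deg by (auto simp: fball_iff fls_subdegree_poly_to_k)
    then have "poly_to_k y' * (vec_to_k p + A *v vec_to_k q) $ i \<in> fball (int (l + l') - int T)"
      "poly_to_k y * (vec_to_k p' + A *v vec_to_k q') $ i \<in> fball (int (l + l') - int T)"
      using fball_mult A by (auto intro!: fball_mono[OF fball_mult] simp: T_def)
    from fball_diff[OF this] show ?thesis
      by (simp add: distrib_left parv poly_to_k_diff poly_to_k_mult vec_to_k_nth)
  qed
  have Pi: "degree g < N" "y' * p $ i - y * p' $ i \<in> polys_below N" if pp: "(p, p') \<in> V" for p p' :: "'a poly ^ 'm" and i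
  proof -
    from pp obtain A where A: "A \<in> E (p, p')" and p: "p \<in> numerators i0 j y" "p' \<in> numerators i0 j' y'"
      by (auto simp: V_def)
    define D where "D = y' * p $ i0 - y * p' $ i0"
    \<comment> \<open>Here coprimality enters: D = 0 would make y and y' divide each other, hence
      equal. A non-zero D is a multiple of g, and this gives deg g < N.\<close>
    have "D \<noteq> 0"
    proof
      assume "D = 0"
      then have eq: "y' * p $ i0 = y * p' $ i0" by (simp add: D_def)
      have "y dvd y'"
        using comaximal_dvd_mult[OF numerators_comaximal[OF p(1)], of y'] eq by simp
      moreover have "y' dvd y"
        using comaximal_dvd_mult[OF numerators_comaximal[OF p(2)], of y] eq by (metis dvd_triv_left)
      ultimately show False using monics_dvd_antisym[OF y] \<open>y \<noteq> y'\<close> by blast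
    qed
    have "g dvd D" unfolding D_def using g(2,3) by (intro dvd_diff dvd_mult2)
    with \<open>D \<noteq> 0\<close> have "degree g \<le> degree D" by (intro dvd_imp_degree_le)
    moreover have "int (l + l') - int T \<le> - int (degree D)"
      using close[OF A, of i0] \<open>D \<noteq> 0\<close> by (simp add: fball_iff fls_subdegree_poly_to_k flip: D_def)
    ultimately show gN: "degree g < N" by (simp add: N_def)
    then have "int (l + l') - int T = 1 - int N" by (simp add: N_def)
    with close[OF A, of i] show "y' * p $ i - y * p' $ i \<in> polys_below N"
      by (simp add: poly_to_k_fball_iff)
  qed
  have fin: "finite V"
    by (rule finite_subset[of _ "numerators i0 j y \<times> numerators i0 j' y'"]) (auto simp: V_def)
  have Ev: "E pp \<in> events" for pp
    unfolding E_def by (cases pp) (auto intro!: event_sets stable_conj stable_affine)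
  have single: "prob (E pp) \<le> 1 / s ^ (T * CARD('m))" if "pp \<in> V" for pp
  proof -
    obtain p p' where pp: "pp = (p, p')" by force
    have p: "p $ i \<in> polys_below (Suc j)" "p' $ i \<in> polys_below (Suc j')" for i
      using that numerators_below[of p i0 j y i] numerators_below[of p' i0 j' y' i]
      by (auto simp: V_def pp polys_below_iff)
    have "prob (E pp) \<le> prob {A \<in> mball 0. vec_to_k p + A *v vec_to_k q \<in> vball (int l)}"
      by (intro finite_measure_mono event_sets stable_affine) (auto simp: E_def pp)
    also have "\<dots> = 1 / s ^ ((l + j) * CARD('m))"
      unfolding s_def using denominators_k0[OF q(1)] denominators_below[OF q(1)] p
      by (intro prob_affine) (auto simp: monics_def)
    finally have 1: "prob (E pp) \<le> 1 / s ^ ((l + j) * CARD('m))" .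
    have "prob (E pp) \<le> prob {A \<in> mball 0. vec_to_k p' + A *v vec_to_k q' \<in> vball (int l')}"
      by (intro finite_measure_mono event_sets stable_affine) (auto simp: E_def pp)
    also have "\<dots> = 1 / s ^ ((l' + j') * CARD('m))"
      unfolding s_def using denominators_k0[OF q(2)] denominators_below[OF q(2)] p
      by (intro prob_affine) (auto simp: monics_def)
    finally have 2: "prob (E pp) \<le> 1 / s ^ ((l' + j') * CARD('m))" .
    from 1 2 show ?thesis by (auto simp: T_def max_def)
  qed
  have sub: "approx_event i0 k0 j l q \<inter> approx_event i0 k0 j' l' q' \<subseteq> (\<Union>pp\<in>V. E pp)"
    by (auto simp: approx_event_def V_def E_def y_def y'_def) 
  show ?thesis
  proof (cases "V = {}")
    case True
    then have "approx_event i0 k0 j l q \<inter> approx_event i0 k0 j' l' q' = {}" using sub by simp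
    then show ?thesis by simp
  next
    case False
    then obtain p p' where pp: "(p, p') \<in> V" by auto
    have gN: "degree g < N" using Pi(1)[OF pp] .
    have finS: "finite S"
      by (rule finite_subset[of _ "polys_below j \<times> polys_below j'"]) (auto simp: S_def)
    have "inj_on (\<lambda>(p, p'). \<chi> i. (p $ i, p' $ i)) V"
      by (auto simp: inj_on_def vec_eq_iff)
    moreover have "(\<lambda>(p, p'). \<chi> i. (p $ i, p' $ i)) ` V \<subseteq> {v :: ('a poly \<times> 'a poly) ^ 'm. \<forall>i. v $ i \<in> S}"
    proof clarify
      fix p p' i assume pp: "(p, p') \<in> V"
      then have "p $ i \<in> polys_below j" "p' $ i \<in> polys_below j'"
        by (auto simp: V_def numerators_below)
      then show "(\<chi> i. (p $ i, p' $ i)) $ i \<in> S" using Pi(2)[OF pp] by (simp add: S_def)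
    qed
    ultimately have "card V \<le> card {v :: ('a poly \<times> 'a poly) ^ 'm. \<forall>i. v $ i \<in> S}"
      using finite_card_vec[of "\<lambda>_. S"] finS by (intro card_inj_on_le) auto
    also have "\<dots> = card S ^ CARD('m)"
      using finite_card_vec[of "\<lambda>_. S"] finS by auto
    also have "\<dots> \<le> (CARD('a) ^ N) ^ CARD('m)"
      unfolding S_def using card_close_pairs_le[OF deg(1) monics_nonzero[OF y(1)] g gN]
      by (intro power_mono) auto
    finally have "real (card V) \<le> real ((CARD('a) ^ N) ^ CARD('m))" by (rule of_nat_mono)
    then have card: "real (card V) \<le> s ^ (N * CARD('m))" by (simp add: s_def power_mult)
    have "prob (approx_event i0 k0 j l q \<inter> approx_event i0 k0 j' l' q') \<le> prob (\<Union>pp\<in>V. E pp)"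
      using fin Ev by (intro finite_measure_mono sub sets.finite_UN) auto
    also have "\<dots> \<le> (\<Sum>pp\<in>V. prob (E pp))"
      using fin Ev by (intro finite_measure_subadditive_finite) auto
    also have "\<dots> \<le> real (card V) * (1 / s ^ (T * CARD('m)))"
      using single by (intro sum_bounded_above) auto
    also have "\<dots> \<le> s ^ (N * CARD('m)) * (1 / s ^ (T * CARD('m)))"
      using s by (intro mult_right_mono card) auto
    also have "\<dots> = s ^ CARD('m) / (s ^ (l * CARD('m)) * s ^ (l' * CARD('m)))"
    proof -
      have "N + l + l' = T + 1" using gN by (simp add: N_def)
      then have "N * CARD('m) + l * CARD('m) + l' * CARD('m) = T * CARD('m) + CARD('m)"
        by (metis add_mult_distrib mult_1)
      then have "s ^ (N * CARD('m)) * s ^ (l * CARD('m)) * s ^ (l' * CARD('m)) = s ^ (T * CARD('m)) * s ^ CARD('m)"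
        by (metis power_add)
      then show ?thesis using s by (simp add: field_simps)
    qed
    finally show ?thesis by (simp add: s_def)
  qed
qed

text \<open>The constant s^(2m) comes from the independent case: modulo Z a ball of radius s^-l has
  measure s^(1-l) in each coordinate, which loses s^m for each of the two denominators. The parallel
  case loses only s^m in total.\<close>

lemma prob_pair_le:
  fixes q q' :: "'a poly ^ 'n"
  assumes q: "q \<in> denominators k0 j" "q' \<in> denominators k0 j'" "q \<noteq> q'" and l: "l \<ge> 1" "l' \<ge> 1"
  shows "prob (approx_event i0 k0 j l q \<inter> approx_event i0 k0 j' l' q') \<le>
    real CARD('a) ^ (2 * CARD('m)) * (1 / real CARD('a) ^ (l * CARD('m))) * (1 / real CARD('a) ^ (l' * CARD('m)))"
proof -
  define s where "s = real CARD('a)"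
  have s: "s > 1" unfolding s_def by (rule card_gt_1)
  have shift: "s ^ (c * CARD('m)) = s ^ CARD('m) * s ^ ((c - 1) * CARD('m))" if "c \<ge> 1" for c
    using that by (cases c) (simp_all add: power_add)
  show ?thesis
  proof (cases "\<forall>k. q $ k0 * q' $ k = q $ k * q' $ k0")
    case True
    then have "prob (approx_event i0 k0 j l q \<inter> approx_event i0 k0 j' l' q') \<le>
      s ^ CARD('m) / (s ^ (l * CARD('m)) * s ^ (l' * CARD('m)))"
      unfolding s_def by (intro prob_pair_parallel assms) auto
    also have "\<dots> \<le> s ^ (2 * CARD('m)) / (s ^ (l * CARD('m)) * s ^ (l' * CARD('m)))"
      using s by (intro divide_right_mono power_increasing) auto
    finally show ?thesis by (simp add: s_def)
  next
    case False
    then obtain k where k: "q $ k0 * q' $ k \<noteq> q $ k * q' $ k0" by blast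
    have "prob (approx_event i0 k0 j l q \<inter> approx_event i0 k0 j' l' q') \<le>
      prob {A \<in> mball 0. (\<exists>p. vec_to_k p + A *v vec_to_k q \<in> vball (int l)) \<and>
      (\<exists>p. vec_to_k p + A *v vec_to_k q' \<in> vball (int l'))}"
      by (intro finite_measure_mono event_sets stable_conj stable_ex_affine) (auto simp: approx_event_def)
    also have "\<dots> \<le> 1 / (s ^ ((l - 1) * CARD('m)) * s ^ ((l' - 1) * CARD('m)))"
      unfolding s_def using k l by (rule prob_pair_independent)
    also have "\<dots> = s ^ (2 * CARD('m)) * (1 / s ^ (l * CARD('m))) * (1 / s ^ (l' * CARD('m)))"
      using s by (simp add: shift[OF l(1)] shift[OF l(2)] mult_2 power_add)
    finally show ?thesis by (simp add: s_def)
  qed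
qed

end

subsection \<open>Limit superior of the approximation events\<close>

text \<open>Cauchy condensation, to be used with b = s^n, because the n-th powers of the norms of
  non-zero polynomial vectors are the numbers b^j.\<close>

lemma condensation_test_base:
  fixes f :: "nat \<Rightarrow> real" and b :: nat
  assumes b: "b \<ge> 2" and nonneg: "\<And>x. x \<ge> 1 \<Longrightarrow> f x \<ge> 0"
    and dec: "\<And>x y. 1 \<le> x \<Longrightarrow> x \<le> y \<Longrightarrow> f y \<le> f x"
  shows "summable (\<lambda>x. f (Suc x)) \<longleftrightarrow> summable (\<lambda>j. real b ^ j * f (b ^ j))"
proof
  have pos: "1 \<le> b ^ j" for j using b by simp
  assume sm: "summable (\<lambda>x. f (Suc x))"
  have block: "real b ^ Suc j * f (b ^ Suc j) \<le> 2 * (\<Sum>x\<in>{b ^ j<..b ^ Suc j}. f x)" for j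
  proof -
    \<comment> \<open>The block from b^j to b^(j+1) contains at least half of the first b^(j+1)
      integers; this is the factor 2.\<close>
    have "2 * b ^ j \<le> b ^ Suc j" using b by simp
    then have "b ^ Suc j \<le> 2 * (b ^ Suc j - b ^ j)" by linarith
    then have "real (b ^ Suc j) \<le> 2 * real (b ^ Suc j - b ^ j)" by linarith
    then have "real b ^ Suc j * f (b ^ Suc j) \<le> 2 * real (b ^ Suc j - b ^ j) * f (b ^ Suc j)"
      using nonneg[OF pos[of "Suc j"]] by (intro mult_right_mono) auto
    also have "\<dots> = 2 * (\<Sum>x\<in>{b ^ j<..b ^ Suc j}. f (b ^ Suc j))" by simp
    also have "\<dots> \<le> 2 * (\<Sum>x\<in>{b ^ j<..b ^ Suc j}. f x)"
      using pos[of j] by (intro mult_left_mono sum_mono dec) auto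
    finally show ?thesis .
  qed
  have partial: "(\<Sum>j<J. real b ^ Suc j * f (b ^ Suc j)) \<le> 2 * (\<Sum>x\<in>{1<..b ^ J}. f x)" for J
  proof (induction J)
    case (Suc J)
    have "{1<..b ^ Suc J} = {1<..b ^ J} \<union> {b ^ J<..b ^ Suc J}"
      using pos[of J] b by (intro ivl_disj_un_two(6)[symmetric]) auto
    then have "(\<Sum>x\<in>{1<..b ^ Suc J}. f x) = (\<Sum>x\<in>{1<..b ^ J}. f x) + (\<Sum>x\<in>{b ^ J<..b ^ Suc J}. f x)"
      by (simp only:) (intro sum.union_disjoint, auto)
    then show ?case using Suc.IH block[of J] by simp
  qed simp
  have "(\<Sum>j<J. real b ^ Suc j * f (b ^ Suc j)) \<le> 2 * (\<Sum>x. f (Suc x))" for J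
  proof -
    have "(\<Sum>x\<in>{1<..b ^ J}. f x) \<le> (\<Sum>x\<in>Suc ` {..<b ^ J}. f x)"
    proof (rule sum_mono2)
      show "{1<..b ^ J} \<subseteq> Suc ` {..<b ^ J}"
      proof
        fix x assume "x \<in> {1<..b ^ J}"
        then show "x \<in> Suc ` {..<b ^ J}" by (intro image_eqI[of _ _ "x - 1"]) auto
      qed
    qed (use nonneg in auto)
    also have "\<dots> = (\<Sum>x<b ^ J. f (Suc x))" by (simp add: sum.reindex)
    also have "\<dots> \<le> (\<Sum>x. f (Suc x))" using nonneg by (intro sum_le_suminf sm) auto
    finally show ?thesis using partial[of J] by simp
  qed
  then have "summable (\<lambda>j. real b ^ Suc j * f (b ^ Suc j))"
    using nonneg pos by (intro summableI_nonneg_bounded) (auto intro!: mult_nonneg_nonneg simp del: power_Suc)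
  then show "summable (\<lambda>j. real b ^ j * f (b ^ j))" by (subst (asm) summable_Suc_iff)
next
  have pos: "1 \<le> b ^ j" for j using b by simp
  assume sm: "summable (\<lambda>j. real b ^ j * f (b ^ j))"
  have partial: "(\<Sum>x\<in>{1..<b ^ J}. f x) \<le> real b * (\<Sum>j<J. real b ^ j * f (b ^ j))" for J
  proof (induction J)
    case (Suc J)
    have "{1..<b ^ Suc J} = {1..<b ^ J} \<union> {b ^ J..<b ^ Suc J}"
      using pos[of J] b by (intro ivl_disj_un_two(3)[symmetric]) auto
    then have "(\<Sum>x\<in>{1..<b ^ Suc J}. f x) = (\<Sum>x\<in>{1..<b ^ J}. f x) + (\<Sum>x\<in>{b ^ J..<b ^ Suc J}. f x)"
      by (simp only:) (intro sum.union_disjoint, auto)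
    also have "(\<Sum>x\<in>{b ^ J..<b ^ Suc J}. f x) \<le> (\<Sum>x\<in>{b ^ J..<b ^ Suc J}. f (b ^ J))"
      using pos[of J] by (intro sum_mono dec) auto
    also have "\<dots> = real (b ^ Suc J - b ^ J) * f (b ^ J)" by simp
    also have "\<dots> \<le> real (b ^ Suc J) * f (b ^ J)"
      using nonneg[OF pos[of J]] by (intro mult_right_mono) linarith+
    finally show ?case using Suc.IH by (simp add: algebra_simps)
  qed simp
  have "(\<Sum>x<n. f (Suc x)) \<le> real b * (\<Sum>j. real b ^ j * f (b ^ j))" for n
  proof -
    have "n < b ^ n" using b by (intro power_gt_expt) auto
    have "(\<Sum>x<n. f (Suc x)) = (\<Sum>x\<in>Suc ` {..<n}. f x)" by (simp add: sum.reindex)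
    also have "\<dots> \<le> (\<Sum>x\<in>{1..<b ^ n}. f x)"
      using \<open>n < b ^ n\<close> nonneg by (intro sum_mono2) auto
    also have "\<dots> \<le> real b * (\<Sum>j<n. real b ^ j * f (b ^ j))" by (rule partial)
    also have "\<dots> \<le> real b * (\<Sum>j. real b ^ j * f (b ^ j))"
      using nonneg pos by (intro mult_left_mono sum_le_suminf sm) auto
    finally show ?thesis .
  qed
  then show "summable (\<lambda>x. f (Suc x))"
    using nonneg by (intro summableI_nonneg_bounded) auto
qed

context haar_matrices
begin

text \<open>Divergence provides, beyond any degree M, a block of degrees whose weights sum to S0 >
  4. The sum S of the probabilities is at least S0 / 4, so S >= 1. In the double sum the diagonal is
  S <= S^2 and the rest is at most s^(2m) S0^2 <= 16 s^(2m) S^2, so the Chung--Erdos inequality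
  yields 1 / (1 + 16 s^(2m)) for every tail \<open>U M\<close>, and continuity from above yields it
  for their intersection.\<close>

lemma limsup_event_large:
  fixes l :: "nat \<Rightarrow> nat"
  assumes l: "\<And>j. l j \<ge> 1"
    and div: "\<not> summable (\<lambda>j. real CARD('a) ^ (j * CARD('n)) / real CARD('a) ^ (l j * CARD('m)))"
  obtains S where "S \<in> events" "prob S \<ge> 1 / (1 + 16 * real CARD('a) ^ (2 * CARD('m)))"
    "\<And>A M. A \<in> S \<Longrightarrow> \<exists>j\<ge>M. \<exists>q\<in>denominators k0 j. \<exists>p. vec_to_k p + A *v vec_to_k q \<in> vball (int (l j))"
proof -
  define s where "s = real CARD('a)"
  define w where "w = (\<lambda>j. s ^ (j * CARD('n)) / s ^ (l j * CARD('m)))"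
  define i0 :: 'm where "i0 = undefined"
  define U where "U = (\<lambda>M. \<Union>j\<in>{M..}. \<Union>q\<in>denominators k0 j. approx_event i0 k0 j (l j) q)"
  have s: "s > 1" unfolding s_def by (rule card_gt_1)
  have w0: "w j \<ge> 0" for j using s by (simp add: w_def)
  have UM: "U M \<in> events" for M
    unfolding U_def by (intro sets.countable_UN') (auto intro!: sets.finite_UN approx_event_sets)
  have large: "prob (U M) \<ge> 1 / (1 + 16 * s ^ (2 * CARD('m)))" for M
  proof -
    have "\<not> summable (\<lambda>j. w (j + M))" using div summable_iff_shift[of w M] by (simp add: w_def s_def)
    then have "\<not> (\<forall>L. (\<Sum>j<L. w (j + M)) \<le> 4)"
      using summableI_nonneg_bounded[of "\<lambda>j. w (j + M)" 4] w0 by blast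
    then obtain L where L: "(\<Sum>j<L. w (j + M)) > 4" by (auto simp: not_le)
    define J where "J = (SIGMA j:{M..<M + L}. (denominators k0 j :: ('a poly ^ 'n) set))"
    define E where "E = (\<lambda>(j, q). approx_event i0 k0 j (l j) q)"
    define S0 where "S0 = (\<Sum>j\<in>{M..<M + L}. w j)"
    define S where "S = (\<Sum>x\<in>J. prob (E x))"
    define v where "v = (\<lambda>(j, q :: 'a poly ^ 'n). 1 / s ^ (l j * CARD('m)))"
    have "S0 = (\<Sum>j<L. w (j + M))"
      unfolding S0_def by (rule sum.reindex_bij_witness[of _ "\<lambda>j. j + M" "\<lambda>j. j - M"]) auto
    with L have S0: "S0 > 4" by simp
    have fin: "finite J" by (simp add: J_def)
    have E: "E x \<in> events" for x by (cases x) (simp add: E_def approx_event_sets)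
    have "S0 / 4 \<le> S"
    proof -
      have "S0 / 4 = (\<Sum>j\<in>{M..<M + L}. w j / 4)" by (simp add: S0_def sum_divide_distrib)
      also have "\<dots> \<le> (\<Sum>j\<in>{M..<M + L}. \<Sum>q\<in>denominators k0 j. prob (approx_event i0 k0 j (l j) q))"
        unfolding w_def s_def by (intro sum_mono sum_prob_approx_event l)
      also have "\<dots> = S"
        unfolding S_def J_def E_def by (subst sum.Sigma) (auto intro!: sum.cong)
      finally show ?thesis .
    qed
    then have S: "S \<ge> 1" "S0 \<le> 4 * S" using S0 by auto
    have v: "(\<Sum>x\<in>J. v x) = S0"
    proof -
      have "(\<Sum>x\<in>J. v x) = (\<Sum>j\<in>{M..<M + L}. \<Sum>q\<in>(denominators k0 j :: ('a poly ^ 'n) set). 1 / s ^ (l j * CARD('m)))"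
        unfolding J_def v_def by (subst sum.Sigma) auto
      then show ?thesis by (simp add: card_denominators S0_def w_def s_def)
    qed
    have pair: "prob (E x \<inter> E y) \<le> (if x = y then prob (E x) else 0) + s ^ (2 * CARD('m)) * v x * v y"
      if "x \<in> J" "y \<in> J" for x y
    proof (cases "x = y")
      case True
      have "0 \<le> s ^ (2 * CARD('m)) * v x * v y" using s by (auto simp: v_def split_beta)
      then show ?thesis using True by simp
    next
      case False
      obtain j q j' q' where xy: "x = (j, q)" "y = (j', q')" by (cases x, cases y) auto
      have q: "q \<in> denominators k0 j" "q' \<in> denominators k0 j'" using that by (auto simp: J_def xy)
      have "q \<noteq> q'"
      proof
        assume "q = q'"
        moreover have "j = j'" using denominators_k0[OF q(1)] denominators_k0[OF q(2)] \<open>q = q'\<close>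
          by (simp add: monics_def)
        ultimately show False using False xy by simp
      qed
      from prob_pair_le[OF q this l l, of i0] show ?thesis
        using False by (simp add: E_def xy v_def s_def)
    qed
    have "(\<Sum>x\<in>J. \<Sum>y\<in>J. prob (E x \<inter> E y)) \<le>
      (\<Sum>x\<in>J. \<Sum>y\<in>J. (if x = y then prob (E x) else 0) + s ^ (2 * CARD('m)) * v x * v y)"
      by (intro sum_mono pair)
    also have "\<dots> = S + s ^ (2 * CARD('m)) * S0\<^sup>2"
      using fin by (simp add: sum.distrib S_def power2_eq_square sum_distrib_left[symmetric]
          sum_distrib_right[symmetric] v mult.assoc)
    also have "\<dots> \<le> S * S + s ^ (2 * CARD('m)) * (4 * S)\<^sup>2"
      using S S0 s by (intro add_mono mult_left_mono power_mono) auto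
    finally have S2: "(\<Sum>x\<in>J. \<Sum>y\<in>J. prob (E x \<inter> E y)) \<le> S\<^sup>2 * (1 + 16 * s ^ (2 * CARD('m)))"
      by (simp add: power2_eq_square algebra_simps)
    have "S\<^sup>2 \<le> prob (\<Union>x\<in>J. E x) * (\<Sum>x\<in>J. \<Sum>y\<in>J. prob (E x \<inter> E y))"
      unfolding S_def using fin E by (intro chung_erdos) auto
    also have "\<dots> \<le> prob (\<Union>x\<in>J. E x) * (S\<^sup>2 * (1 + 16 * s ^ (2 * CARD('m))))"
      by (intro mult_left_mono S2) auto
    finally have "S\<^sup>2 * 1 \<le> S\<^sup>2 * (prob (\<Union>x\<in>J. E x) * (1 + 16 * s ^ (2 * CARD('m))))"
      by (simp add: mult_ac)
    then have "1 \<le> prob (\<Union>x\<in>J. E x) * (1 + 16 * s ^ (2 * CARD('m)))"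
      using S(1) by (subst (asm) mult_le_cancel_left_pos) auto
    moreover have "1 + 16 * s ^ (2 * CARD('m)) > 0" using s by (simp add: add_pos_pos)
    ultimately have "1 / (1 + 16 * s ^ (2 * CARD('m))) \<le> prob (\<Union>x\<in>J. E x)"
      by (simp add: pos_divide_le_eq)
    also have "\<dots> \<le> prob (U M)"
      by (intro finite_measure_mono UM) (auto simp: U_def J_def E_def)
    finally show ?thesis .
  qed
  have "decseq U" unfolding U_def by (intro decseq_SucI) fastforce
  then have "(\<lambda>M. prob (U M)) \<longlonglongrightarrow> prob (\<Inter>M. U M)"
    using UM by (intro finite_Lim_measure_decseq) auto
  then have "1 / (1 + 16 * s ^ (2 * CARD('m))) \<le> prob (\<Inter>M. U M)"
    using large by (intro LIMSEQ_le_const) auto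
  moreover have "(\<Inter>M. U M) \<in> events" using UM by auto
  moreover have "\<exists>j\<ge>M. \<exists>q\<in>denominators k0 j. \<exists>p. vec_to_k p + A *v vec_to_k q \<in> vball (int (l j))"
    if "A \<in> (\<Inter>M. U M)" for A M
  proof -
    have "A \<in> U M" using that by blast
    then show ?thesis by (fastforce simp: U_def approx_event_def)
  qed
  ultimately show ?thesis using that[of "\<Inter>M. U M"] by (simp add: s_def)
qed

end

subsection \<open>Norms\<close>

lemma sup_norm_ge: "absval (v $ i) \<le> sup_norm v"
  unfolding sup_norm_def by (intro Max_ge) auto

lemma absval_nonneg: "absval x \<ge> 0"
  by (simp add: absval_def)

lemma sup_norm_nonneg: "sup_norm v \<ge> 0"
  using order_trans[OF absval_nonneg sup_norm_ge[of v undefined]] .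

text \<open>The non-zero values of the norm are powers of s, so the strict inequality describes a
  closed ball. The integer c is the least one with s^(-cm) < t, and minimality gives the reverse
  estimate up to the factor s^m.\<close>

lemma power_sup_norm_less_iff:
  assumes "t > 0"
  obtains c :: int where
    "\<And>v :: 'a::{field,finite} fls ^ 'm. sup_norm v ^ CARD('m) < t \<longleftrightarrow> v \<in> vball c"
    "real CARD('a) powi (- c * int CARD('m)) < t"
    "t \<le> real CARD('a) ^ CARD('m) * real CARD('a) powi (- c * int CARD('m))"
proof -
  define s where "s = real CARD('a)"
  define m where "m = CARD('m)"
  have s: "s > 1" unfolding s_def by (rule card_gt_1)
  have m: "m > 0" by (simp add: m_def)
  define B where "B = s ^ m"
  have B: "B > 1" unfolding B_def using s m by (intro one_less_power) auto
  define c where "c = \<lfloor>- log B t\<rfloor> + 1"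
  have powi: "s powi (x * int m) = B powr of_int x" for x
  proof -
    have "s powi (x * int m) = s powr of_int (x * int m)" using s powr_real_of_int'[of s "x * int m"] by simp
    also have "\<dots> = (s powr real m) powr of_int x" using s by (simp add: powr_powr mult.commute)
    also have "s powr real m = B" using s by (simp add: powr_realpow B_def)
    finally show ?thesis .
  qed
  have t: "t = B powr log B t" using B assms by simp
  have 1: "s powi (- c * int m) < t"
  proof -
    have "of_int (- c) < log B t" unfolding c_def by linarith
    then have "B powr of_int (- c) < B powr log B t" using B by simp
    then show ?thesis unfolding powi t[symmetric] .
  qed
  have 2: "t \<le> s powi ((1 - c) * int m)"
  proof -
    have "log B t \<le> of_int (1 - c)" unfolding c_def by linarith
    then have "B powr log B t \<le> B powr of_int (1 - c)" using B by simp
    then show ?thesis unfolding powi t[symmetric] .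
  qed
  have "sup_norm v ^ m < t \<longleftrightarrow> v \<in> vball c" for v :: "'a fls ^ 'm"
  proof
    assume *: "sup_norm v ^ m < t"
    show "v \<in> vball c"
    proof (rule ccontr)
      assume "v \<notin> vball c"
      then obtain i where i: "v $ i \<noteq> 0" "fls_subdegree (v $ i) < c"
        by (auto simp: vball_def fball_iff)
      have "s powi (1 - c) \<le> s powi (- fls_subdegree (v $ i))"
        using i s by (intro power_int_increasing) auto
      also have "\<dots> = absval (v $ i)" using i by (simp add: absval_def s_def)
      also have "\<dots> \<le> sup_norm v" by (rule sup_norm_ge)
      finally have "(s powi (1 - c)) ^ m \<le> sup_norm v ^ m" using s by (intro power_mono) auto
      then have "t \<le> sup_norm v ^ m" using 2 by (simp add: power_int_mult)
      with * show False by simp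
    qed
  next
    assume "v \<in> vball c"
    then have "sup_norm v \<le> s powi (- c)" by (simp add: vball_sup_norm s_def)
    then have "sup_norm v ^ m \<le> (s powi (- c)) ^ m" by (intro power_mono sup_norm_nonneg)
    also have "\<dots> = s powi (- c * int m)" by (simp only: power_int_mult power_int_of_nat)
    finally show "sup_norm v ^ m < t" using 1 by simp
  qed
  moreover have "s powi ((1 - c) * int m) = s ^ m * s powi (- c * int m)"
  proof -
    have "(1 - c) * int m = int m + (- c * int m)" by (simp add: algebra_simps)
    then show ?thesis
      using s power_int_add[of s "int m" "- c * int m"] by (simp only: power_int_of_nat) simp
  qed
  ultimately show ?thesis using that[of c] 1 2 by (simp add: s_def m_def)
qed

section \<open>Polynomial vectors graded by degree\<close>

definition poly_vectors_below :: "nat \<Rightarrow> ('a::{field,finite} poly ^ 'n) set" where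
  "poly_vectors_below d = {q. \<forall>k. q $ k \<in> polys_below d}"

lemma finite_poly_vectors_below [simp]: "finite (poly_vectors_below d)"
  unfolding poly_vectors_below_def by (rule finite_card_vec[THEN conjunct1]) auto

lemma card_poly_vectors_below:
  "card (poly_vectors_below d :: ('a::{field,finite} poly ^ 'n) set) = CARD('a) ^ (d * CARD('n))"
proof -
  have "card (poly_vectors_below d :: ('a poly ^ 'n) set) = (\<Prod>k\<in>(UNIV :: 'n set). card (polys_below d :: 'a poly set))"
    unfolding poly_vectors_below_def by (rule finite_card_vec[THEN conjunct2]) auto
  then show ?thesis by (simp add: card_polys_below power_mult)
qed

lemma poly_vectors_below_mono: "q \<in> poly_vectors_below d \<Longrightarrow> d \<le> e \<Longrightarrow> q \<in> poly_vectors_below e"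
  by (auto simp: poly_vectors_below_def polys_below_def)

lemma poly_vector_below_ex: "\<exists>d. q \<in> poly_vectors_below d"
proof -
  have "q \<in> poly_vectors_below (Suc (Max (range (\<lambda>k. degree (q $ k)))))"
    by (auto simp: poly_vectors_below_def polys_below_iff less_Suc_eq_le)
  then show ?thesis by blast
qed

definition poly_vectors_degree :: "nat \<Rightarrow> ('a::{field,finite} poly ^ 'n) set" where
  "poly_vectors_degree j = poly_vectors_below (Suc j) - poly_vectors_below j"

lemma poly_vectors_degree_ex:
  assumes "q \<notin> poly_vectors_below M"
  shows "\<exists>j\<ge>M. q \<in> poly_vectors_degree j"
proof -
  define d where "d = (LEAST d. q \<in> poly_vectors_below d)"
  have d: "q \<in> poly_vectors_below d" unfolding d_def using poly_vector_below_ex by (rule LeastI_ex)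
  have "M < d" using assms d poly_vectors_below_mono by (metis linorder_not_less)
  then obtain j where j: "d = Suc j" "j \<ge> M" by (cases d) auto
  have "q \<notin> poly_vectors_below j" using not_less_Least[of j "\<lambda>d. q \<in> poly_vectors_below d"] j by (simp add: d_def)
  then show ?thesis using d j by (auto simp: poly_vectors_degree_def)
qed

lemma sup_norm_poly_vector:
  fixes q :: "'a::{field,finite} poly ^ 'n"
  assumes "q \<in> poly_vectors_degree j"
  shows "sup_norm (vec_to_k q) = real CARD('a) ^ j"
proof (rule antisym)
  have "poly_to_k (q $ k) \<in> fball (- int j)" for k
    using assms poly_to_k_fball_iff[of "q $ k" "Suc j"]
    by (auto simp: poly_vectors_degree_def poly_vectors_below_def)
  then have "vec_to_k q \<in> vball (- int j)" by (simp add: vball_def vec_to_k_def)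
  then show "sup_norm (vec_to_k q) \<le> real CARD('a) ^ j" by (simp add: vball_sup_norm)
next
  obtain k where k: "q $ k \<notin> polys_below j" "q $ k \<in> polys_below (Suc j)"
    using assms by (auto simp: poly_vectors_degree_def poly_vectors_below_def)
  then have "q $ k \<noteq> 0" "degree (q $ k) = j" by (auto simp: polys_below_iff)
  then have "absval (vec_to_k q $ k) = real CARD('a) ^ j"
    by (simp add: absval_def vec_to_k_def fls_subdegree_poly_to_k)
  then show "real CARD('a) ^ j \<le> sup_norm (vec_to_k q)" using sup_norm_ge by metis
qed

lemma denominators_degree: "q \<in> denominators k0 j \<Longrightarrow> q \<in> poly_vectors_degree j"
  using denominators_below[of q k0 j] denominators_k0[of q k0 j]
  by (auto simp: poly_vectors_degree_def poly_vectors_below_def polys_below_iff monics_def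
      intro!: exI[of _ k0])

section \<open>The approximation condition for a single denominator\<close>

definition approximable :: "(real \<Rightarrow> real) \<Rightarrow> 'a::{field,finite} poly ^ 'n \<Rightarrow> 'a fls ^ 'n ^ 'm \<Rightarrow> bool" where
  "approximable \<psi> q A \<longleftrightarrow> (\<exists>p. sup_norm (vec_to_k p + A *v vec_to_k q) ^ CARD('m)
     < \<psi> (sup_norm (vec_to_k q) ^ CARD('n)))"

lemma approximable_pos: "approximable \<psi> q A \<Longrightarrow> \<psi> (sup_norm (vec_to_k q) ^ CARD('n)) > 0"
  for q :: "'a::{field,finite} poly ^ 'n"
  unfolding approximable_def by (blast intro: le_less_trans[OF zero_le_power[OF sup_norm_nonneg]])

lemma stable_approximable: "stable (\<lambda>A :: 'a::{field,finite} fls ^ 'n ^ 'm. approximable \<psi> q A)"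
proof (cases "\<psi> (sup_norm (vec_to_k q) ^ CARD('n)) > 0")
  case True
  obtain c where c: "\<And>v :: 'a fls ^ 'm. sup_norm v ^ CARD('m) < \<psi> (sup_norm (vec_to_k q) ^ CARD('n)) \<longleftrightarrow> v \<in> vball c"
    using power_sup_norm_less_iff[OF True] by metis
  show ?thesis unfolding approximable_def c by (rule stable_ex_affine)
next
  case False
  then have "\<not> approximable \<psi> q A" for A :: "'a fls ^ 'n ^ 'm" using approximable_pos by blast
  then show ?thesis by (intro stableI) auto
qed

lemma infinite_poly_vectors_iff:
  "infinite Q \<longleftrightarrow> (\<forall>M. \<exists>q\<in>Q. q \<notin> poly_vectors_below M)" for Q :: "('a::{field,finite} poly ^ 'n) set"
proof (intro iffI allI notI)
  fix M assume "infinite Q"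
  then have "\<not> Q \<subseteq> poly_vectors_below M" using finite_poly_vectors_below finite_subset by blast
  then show "\<exists>q\<in>Q. q \<notin> poly_vectors_below M" by blast
next
  assume *: "\<forall>M. \<exists>q\<in>Q. q \<notin> poly_vectors_below M" and fin: "finite Q"
  obtain d where d: "\<And>q :: 'a poly ^ 'n. q \<in> poly_vectors_below (d q)"
    using poly_vector_below_ex by metis
  have "Q \<noteq> {}" using * by blast
  obtain q where q: "q \<in> Q" "q \<notin> poly_vectors_below (Max (d ` Q))" using * by blast
  moreover have "q \<in> poly_vectors_below (Max (d ` Q))"
    using fin q(1) by (intro poly_vectors_below_mono[OF d]) auto
  ultimately show False by simp
qed

lemma W_set_eq:
  "W_set \<psi> = {A \<in> mball 0. \<forall>M. \<exists>q. q \<notin> poly_vectors_below M \<and> approximable \<psi> q A}"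
  unfolding W_set_def infinite_poly_vectors_iff approximable_def mball_0_eq by blast

context haar_matrices
begin

lemma W_set_events: "W_set \<psi> \<in> events"
proof -
  have opn: "open (\<Union>q\<in>- poly_vectors_below M. {A :: 'a fls ^ 'n ^ 'm. approximable \<psi> q A})" for M
    by (intro open_UN ballI stable_open stable_approximable)
  have "(W_set \<psi> :: ('a fls ^ 'n ^ 'm) set) = mball 0 \<inter> (\<Inter>M. \<Union>q\<in>- poly_vectors_below M. {A. approximable \<psi> q A})"
    by (auto simp: W_set_eq)
  also have "\<dots> \<in> sets borel"
    using opn by (intro sets.Int mball_borel sets.countable_INT'') auto
  finally show ?thesis by (auto simp: sets_unit_ball W_set_eq)
qed

lemma prob_approximable_le:
  assumes "q \<noteq> 0" "\<psi> (sup_norm (vec_to_k q) ^ CARD('n)) \<ge> 0"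
  shows "prob {A \<in> mball 0. approximable \<psi> q A} \<le>
    real CARD('a) ^ CARD('m) * \<psi> (sup_norm (vec_to_k q) ^ CARD('n))"
proof -
  define t where "t = \<psi> (sup_norm (vec_to_k q) ^ CARD('n))"
  define s where "s = real CARD('a)"
  have s: "s > 1" unfolding s_def by (rule card_gt_1)
  show ?thesis
  proof (cases "t > 0")
    case False
    then have ev: "{A \<in> mball 0. approximable \<psi> q A} = {}" using approximable_pos by (auto simp: t_def)
    show ?thesis unfolding ev using assms(2) by simp
  next
    case True
    obtain c where c: "\<And>v :: 'a fls ^ 'm. sup_norm v ^ CARD('m) < t \<longleftrightarrow> v \<in> vball c"
      "s powi (- c * int CARD('m)) < t"
      using power_sup_norm_less_iff[OF True] unfolding s_def by metis
    have ev: "{A \<in> mball 0. approximable \<psi> q A} =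
        {A :: 'a fls ^ 'n ^ 'm. A \<in> mball 0 \<and> (\<exists>p. vec_to_k p + A *v vec_to_k q \<in> vball c)}"
      unfolding approximable_def t_def[symmetric] c(1) ..
    show ?thesis
    proof (cases "c \<ge> 1")
      case True
      have "prob {A \<in> mball 0. \<exists>p. vec_to_k p + A *v vec_to_k q \<in> vball (int (nat c))}
        \<le> 1 / s ^ ((nat c - 1) * CARD('m))"
        unfolding s_def using True by (intro prob_near_integer_vector_le assms(1)) auto
      also have "\<dots> = s ^ CARD('m) * s powi (- int (nat c) * int CARD('m))"
      proof -
        obtain d where d: "nat c = Suc d" using True by (cases "nat c") auto
        have "s powi (- int (nat c) * int CARD('m)) = 1 / s ^ (nat c * CARD('m))"
          by (simp only: mult_minus_left of_nat_mult[symmetric] power_int_minus power_int_of_nat inverse_eq_divide)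
        then show ?thesis using s by (simp add: d power_add)
      qed
      also have "\<dots> \<le> s ^ CARD('m) * t" using c(2) True s by (intro mult_left_mono) auto
      finally show ?thesis using True unfolding ev by (simp add: s_def t_def)
    next
      case False
      \<comment> \<open>For c <= 0 the value t is at least 1, and the claimed bound is
        trivial.\<close>
      have "s powi 0 \<le> s powi (- c * int CARD('m))" using s False
        by (intro power_int_increasing) (auto simp: mult_nonpos_nonneg)
      then have "1 \<le> t" using c(2) unfolding power_int_0_right by linarith
      moreover have "1 \<le> s ^ CARD('m)" using s by simp
      ultimately have "1 * 1 \<le> s ^ CARD('m) * t" by (intro mult_mono) auto
      then have "1 \<le> s ^ CARD('m) * t" by simp
      with prob_le_1 show ?thesis unfolding s_def t_def by (rule order_trans)
    qed
  qed
qed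

end

subsection \<open>Self-similarity of the approximable set\<close>

definition scale_X :: "int \<Rightarrow> 'a::{field,finite} fls ^ 'n ^ 'm \<Rightarrow> 'a fls ^ 'n ^ 'm" where
  "scale_X t A = (\<chi> i j. Xpow t * A $ i $ j)"

lemma scale_X_add: "scale_X t (A + B) = scale_X t A + scale_X t B"
  by (simp add: scale_X_def vec_eq_iff distrib_left)

lemma scale_X_diff: "scale_X t (A - B) = scale_X t A - scale_X t B"
  by (simp add: scale_X_def vec_eq_iff right_diff_distrib)

lemma scale_X_inverse: "scale_X t (scale_X (- t) A) = A"
  by (simp add: scale_X_def vec_eq_iff mult.assoc[symmetric] Xpow_inverse)

lemma scale_X_inverse': "scale_X (- t) (scale_X t A) = A"
  using scale_X_inverse[of "- t"] by simp

lemma scale_X_mball_iff: "scale_X t A \<in> mball l \<longleftrightarrow> A \<in> mball (l + t)"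
  by (simp add: scale_X_def mball_def fball_Xpow_mult_iff)

lemma scale_X_borel: "scale_X t \<in> borel_measurable borel"
proof (rule borel_measurableI)
  fix S :: "('a fls ^ 'n ^ 'm) set" assume S: "open S"
  have "open (scale_X t -` S)"
    unfolding open_mball_iff
  proof
    fix A :: "'a fls ^ 'n ^ 'm" assume "A \<in> scale_X t -` S"
    then have "\<exists>u. \<forall>B\<in>mball u. scale_X t A + B \<in> S"
      using S unfolding open_mball_iff by simp
    then obtain u where u: "\<And>B. B \<in> mball u \<Longrightarrow> scale_X t A + B \<in> S" by blast
    have "A + B \<in> scale_X t -` S" if "B \<in> mball (u + t)" for B
      using u[of "scale_X t B"] that by (simp add: scale_X_add scale_X_mball_iff)
    then show "\<exists>u. \<forall>B\<in>mball u. A + B \<in> scale_X t -` S" by blast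
  qed
  then show "scale_X t -` S \<inter> space borel \<in> sets borel" by simp
qed

text \<open>The ball of radius s^-t around X^(1-t) C. For C in \<open>cells t\<close> the entries of
  C encode the coefficients of X^0, ..., X^(1-t), and these balls partition the unit ball.\<close>

definition cell :: "nat \<Rightarrow> 'a::{field,finite} poly ^ 'n ^ 'm \<Rightarrow> 'a fls ^ 'n ^ 'm \<Rightarrow> bool" where
  "cell t C A \<longleftrightarrow> A - scale_X (1 - int t) (poly_matrix C) \<in> mball (int t)"

definition cells :: "nat \<Rightarrow> ('a::{field,finite} poly ^ 'n ^ 'm) set" where
  "cells t = {C. \<forall>i j. C $ i $ j \<in> polys_below t}"

lemma finite_cells [simp]: "finite (cells t :: ('a::{field,finite} poly ^ 'n ^ 'm) set)"
proof -
  have "(cells t :: ('a poly ^ 'n ^ 'm) set) = {C. \<forall>i. C $ i \<in> poly_vectors_below t}"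
    by (auto simp: cells_def poly_vectors_below_def)
  also have "finite \<dots>" by (rule finite_card_vec[THEN conjunct1]) simp
  finally show ?thesis .
qed

lemma stable_cell: "stable (cell t C)" for C :: "'a::{field,finite} poly ^ 'n ^ 'm"
proof (rule stableI[of "int t"])
  fix A B :: "'a fls ^ 'n ^ 'm" assume B: "B \<in> mball (int t)"
  have "A + B - R = (A - R) + B" for R by simp
  then show "cell t C (A + B) \<longleftrightarrow> cell t C A"
    unfolding cell_def by (simp only: mball_add_iff[OF B])
qed

lemma cell_unique: "cell t C A \<Longrightarrow> cell t C' A \<Longrightarrow> C = C'"
proof -
  assume "cell t C A" "cell t C' A"
  then have "scale_X (1 - int t) (poly_matrix C') - scale_X (1 - int t) (poly_matrix C) \<in> mball (int t)"
    unfolding cell_def using mball_diff by fastforce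
  then have "Xpow (1 - int t) * poly_to_k (C' $ i $ j) - Xpow (1 - int t) * poly_to_k (C $ i $ j) \<in> fball (int t)" for i j
    by (simp add: mball_def scale_X_def poly_matrix_def)
  then have "C' $ i $ j = C $ i $ j" for i j by (rule ball_representative_unique)
  then show "C = C'" by (simp add: vec_eq_iff)
qed

lemma cell_centre:
  assumes "C \<in> cells t"
  shows "scale_X (1 - int t) (poly_matrix C) \<in> mball 0"
proof -
  have "Xpow (1 - int t) * poly_to_k (C $ i $ j) \<in> fball 0" for i j
    using ball_representative_fball[of "C $ i $ j" t "int t"] assms by (simp add: cells_def)
  then show ?thesis by (simp add: mball_def scale_X_def poly_matrix_def)
qed

lemma cell_exists:
  assumes "A \<in> mball 0"
  shows "\<exists>C\<in>cells t. cell t C A"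
proof -
  have "\<forall>i j. \<exists>r\<in>polys_below t. A $ i $ j - Xpow (1 - int t) * poly_to_k r \<in> fball (int t)"
    using assms by (intro allI ball_representative_exists) (simp add: mball_def)
  then obtain r where "\<And>i j. r i j \<in> polys_below t"
    "\<And>i j. A $ i $ j - Xpow (1 - int t) * poly_to_k (r i j) \<in> fball (int t)" by metis
  then show ?thesis
    by (intro bexI[of _ "\<chi> i j. r i j"])
      (auto simp: cells_def cell_def mball_def scale_X_def poly_matrix_def)
qed

text \<open>With \<open>q = X\<^sup>t q'\<close>, approximating \<open>X\<^sup>1\<^sup>-\<^sup>tC + X\<^sup>-\<^sup>tA\<close> by \<open>q\<close> amounts to approximating \<open>A\<close> by \<open>q'\<close>.\<close>

lemma W_set_scale:
  fixes A :: "'a::{field,finite} fls ^ 'n ^ 'm"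
  assumes A: "A \<in> W_set (\<lambda>x. \<psi> (real CARD('a) ^ (t * CARD('n)) * x))"
    and C: "C \<in> cells t"
  shows "scale_X (1 - int t) (poly_matrix C) + scale_X (- int t) A \<in> W_set \<psi>"
  unfolding W_set_eq
proof (intro CollectI conjI allI)
  let ?R = "scale_X (1 - int t) (poly_matrix C)"
  have "scale_X (- int t) A \<in> mball 0"
    using A by (auto simp: W_set_eq scale_X_mball_iff intro: mball_mono)
  then show "?R + scale_X (- int t) A \<in> mball 0"
    using cell_centre[OF C] by (intro mball_add)
  fix M
  define \<psi>' where "\<psi>' = (\<lambda>x. \<psi> (real CARD('a) ^ (t * CARD('n)) * x))"
  obtain q where q: "q \<notin> poly_vectors_below M" "approximable \<psi>' q A"
    using A unfolding W_set_eq \<psi>'_def by blast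
  from q(2) obtain p where p: "sup_norm (vec_to_k p + A *v vec_to_k q) ^ CARD('m)
      < \<psi>' (sup_norm (vec_to_k q) ^ CARD('n))" unfolding approximable_def by blast
  obtain j where j: "j \<ge> M" "q \<in> poly_vectors_degree j" using poly_vectors_degree_ex[OF q(1)] by blast
  define Q where "Q = (\<chi> k. monom 1 t * q $ k)"
  have coeffQ: "coeff (Q $ k) i = (if t \<le> i then coeff (q $ k) (i - t) else 0)" for k i
    by (simp add: Q_def coeff_monom_mult)
  have "Q \<in> poly_vectors_below (t + d) \<longleftrightarrow> q \<in> poly_vectors_below d" for d
  proof
    assume Qd: "Q \<in> poly_vectors_below (t + d)"
    have "coeff (q $ k) i = 0" if "i \<ge> d" for k i
    proof -
      have "coeff (Q $ k) (t + i) = 0"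
        using Qd that by (auto simp: poly_vectors_below_def polys_below_def)
      then show ?thesis by (simp add: coeffQ)
    qed
    then show "q \<in> poly_vectors_below d" by (auto simp: poly_vectors_below_def polys_below_def)
  next
    assume "q \<in> poly_vectors_below d"
    then show "Q \<in> poly_vectors_below (t + d)"
      by (auto simp: poly_vectors_below_def polys_below_def coeffQ)
  qed
  from this[of j] this[of "Suc j"] j(2) have Qj: "Q \<in> poly_vectors_degree (t + j)"
    by (simp add: poly_vectors_degree_def)
  have norm: "sup_norm (vec_to_k Q) ^ CARD('n) =
      real CARD('a) ^ (t * CARD('n)) * sup_norm (vec_to_k q) ^ CARD('n)"
    by (simp add: sup_norm_poly_vector[OF Qj] sup_norm_poly_vector[OF j(2)] power_add
        power_mult_distrib power_mult)
  have Qq: "poly_to_k (Q $ k) = Xpow (int t) * poly_to_k (q $ k)" for k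
    by (simp add: Q_def poly_to_k_mult poly_to_k_monom)
  \<comment> \<open>X^(1-t) C X^t q = X C q has polynomial entries, so the contribution of the
    centre is absorbed by the numerator.\<close>
  have "?R *v vec_to_k Q = vec_to_k ((\<chi> i j. [:0, 1:] * C $ i $ j) *v q)"
  proof -
    have X: "poly_to_k [:0, 1:] = Xpow 1"
      using poly_to_k_monom[of 1] by (simp add: monom_Suc one_pCons)
    have "Xpow (1 - int t) * Xpow (int t) = (Xpow 1 :: 'a fls)"
      by (simp only: Xpow_mult) (simp add: Xpow_def)
    then have eq: "Xpow (1 - int t) * x * (Xpow (int t) * y) = Xpow 1 * x * y" for x y :: "'a fls"
      by (metis (no_types) mult.assoc mult.commute)
    show ?thesis
      by (simp add: vec_eq_iff matrix_vector_mult_def vec_to_k_nth Qq eq scale_X_def poly_matrix_def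
          poly_to_k_sum poly_to_k_mult X del: mult_pCons_left)
  qed
  moreover have "scale_X (- int t) A *v vec_to_k Q = A *v vec_to_k q"
  proof -
    have "Xpow (- int t) * Xpow (int t) = (1 :: 'a fls)" using Xpow_inverse[of "- int t"] by simp
    then have eq: "Xpow (- int t) * x * (Xpow (int t) * y) = x * y" for x y :: "'a fls"
      by (metis (no_types) mult.assoc mult.commute mult.left_neutral)
    show ?thesis
      by (simp add: vec_eq_iff matrix_vector_mult_def vec_to_k_nth Qq eq scale_X_def)
  qed
  ultimately have "vec_to_k (p - (\<chi> i j. [:0, 1:] * C $ i $ j) *v q) + (?R + scale_X (- int t) A) *v vec_to_k Q
      = vec_to_k p + A *v vec_to_k q"
    by (simp add: matrix_vector_mult_add_rdistrib vec_to_k_diff)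
  then have "approximable \<psi> Q (?R + scale_X (- int t) A)"
    unfolding approximable_def norm using p unfolding \<psi>'_def by metis
  moreover have "Q \<notin> poly_vectors_below M"
    using Qj j(1) poly_vectors_below_mono[of Q M "t + j"] by (auto simp: poly_vectors_degree_def)
  ultimately show "\<exists>Q. Q \<notin> poly_vectors_below M \<and> approximable \<psi> Q (?R + scale_X (- int t) A)" by blast
qed

text \<open>The bound must not depend on \<open>\<psi>\<close>, since it is applied to all rescalings of \<open>\<psi>\<close>.\<close>

definition lower_bound :: "real \<Rightarrow> nat \<Rightarrow> real" where
  "lower_bound s m = 1 / (1 + 16 * s ^ (2 * m))"

context haar_matrices
begin

lemma sums_at_powers:
  fixes \<psi> :: "real \<Rightarrow> real"
  assumes "\<And>x. x > 0 \<Longrightarrow> \<psi> x \<ge> 0" "antimono_on {0<..} \<psi>"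
  shows "summable (\<lambda>x. \<psi> (real (Suc x))) \<longleftrightarrow>
    summable (\<lambda>j. real CARD('a) ^ (j * CARD('n)) * \<psi> (real CARD('a) ^ (j * CARD('n))))"
proof -
  have "CARD('a) \<ge> 2" using card_gt_1[where 'a='a] by simp
  then have "2 ^ 1 \<le> CARD('a) ^ CARD('n)"
    by (intro order_trans[OF power_increasing[of 1 "CARD('n)" 2] power_mono]) auto
  then have "summable (\<lambda>x. \<psi> (real (Suc x))) \<longleftrightarrow>
    summable (\<lambda>j. real (CARD('a) ^ CARD('n)) ^ j * \<psi> (real ((CARD('a) ^ CARD('n)) ^ j)))"
    using assms by (intro condensation_test_base[where f="\<lambda>x. \<psi> (real x)"]) (auto intro: monotone_onD)
  then show ?thesis by (simp add: power_mult[symmetric] mult.commute)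
qed

lemma prob_W_set_lower_bound:
  fixes \<psi> :: "real \<Rightarrow> real"
  assumes nonneg: "\<And>x. x > 0 \<Longrightarrow> \<psi> x \<ge> 0" and noninc: "antimono_on {0<..} \<psi>"
    and div: "\<not> summable (\<lambda>x. \<psi> (real (Suc x)))"
  shows "prob (W_set \<psi>) \<ge> lower_bound (real CARD('a)) CARD('m)"
proof -
  define s where "s = real CARD('a)"
  have s: "s > 1" unfolding s_def by (rule card_gt_1)
  define b where "b = (\<lambda>j. s ^ (j * CARD('n)))"
  have b: "b j \<ge> 1" for j using s by (simp add: b_def)
  \<comment> \<open>A zero of \<psi> would persist to the right by monotonicity and make the series
    finite.\<close>
  have pos: "\<psi> x > 0" if "x > 0" for x
  proof (rule ccontr)
    assume "\<not> \<psi> x > 0"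
    then have zero: "\<psi> y = 0" if "y \<ge> x" for y
      using nonneg[of y] monotone_onD[OF noninc, of x y] \<open>x > 0\<close> that by auto
    have "\<psi> (real (Suc n)) = 0" if "n \<ge> nat \<lceil>x\<rceil>" for n
      using that by (intro zero) linarith
    then have "eventually (\<lambda>n. \<psi> (real (Suc n)) = 0) sequentially"
      by (rule eventually_sequentiallyI)
    then have "summable (\<lambda>n. \<psi> (real (Suc n)))"
      using summable_cong[of "\<lambda>n. \<psi> (real (Suc n))" "\<lambda>_. 0"] by simp
    with div show False by simp
  qed
  \<comment> \<open>The measure estimates require l >= 1, so radii above that threshold are shrunk.
    This amounts to cutting t off at 1, with a loss of at most s^m.\<close>
  define good where "good = (\<lambda>t l. l \<ge> 1 \<and>
    vball (int l) \<subseteq> {v :: 'a fls ^ 'm. sup_norm v ^ CARD('m) < t} \<and>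
    min 1 t \<le> s ^ CARD('m) * (1 / s ^ (l * CARD('m))))"
  have "\<exists>l. good t l" if t0: "t > 0" for t
  proof -
    obtain c where c: "\<And>v :: 'a fls ^ 'm. sup_norm v ^ CARD('m) < t \<longleftrightarrow> v \<in> vball c"
      "t \<le> s ^ CARD('m) * s powi (- c * int CARD('m))"
      using power_sup_norm_less_iff[OF t0] unfolding s_def by metis
    define l where "l = nat (max 1 c)"
    have "l \<ge> 1" by (simp add: l_def)
    moreover have "vball (int l) \<subseteq> {v :: 'a fls ^ 'm. sup_norm v ^ CARD('m) < t}"
      unfolding c(1) by (auto simp: l_def intro: vball_mono)
    moreover have "min 1 t \<le> s ^ CARD('m) * (1 / s ^ (l * CARD('m)))"
    proof (cases "c \<ge> 1")
      case True
      then have "- c * int CARD('m) = - int (l * CARD('m))" by (simp add: l_def)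
      then have "s powi (- c * int CARD('m)) = 1 / s ^ (l * CARD('m))"
        by (simp only: power_int_minus power_int_of_nat inverse_eq_divide)
      then show ?thesis using c(2) by simp
    next
      case False
      then have "l = 1" by (simp add: l_def)
      then show ?thesis using s by simp
    qed
    ultimately show ?thesis unfolding good_def by blast
  qed
  moreover have "\<psi> (b j) > 0" for j using pos[of "b j"] b[of j] by simp
  ultimately have "\<forall>j. \<exists>l. good (\<psi> (b j)) l" by simp
  from choice[OF this] obtain l where "\<forall>j. good (\<psi> (b j)) (l j)" ..
  then have l: "\<And>j. l j \<ge> 1"
    "\<And>j. vball (int (l j)) \<subseteq> {v :: 'a fls ^ 'm. sup_norm v ^ CARD('m) < \<psi> (b j)}"
    "\<And>j. min 1 (\<psi> (b j)) \<le> s ^ CARD('m) * (1 / s ^ (l j * CARD('m)))"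
    unfolding good_def by simp_all
  have ns: "\<not> summable (\<lambda>j. s ^ (j * CARD('n)) / s ^ (l j * CARD('m)))"
  proof
    assume "summable (\<lambda>j. s ^ (j * CARD('n)) / s ^ (l j * CARD('m)))"
    then have sm: "summable (\<lambda>j. s ^ CARD('m) * (s ^ (j * CARD('n)) / s ^ (l j * CARD('m))))"
      by (rule summable_mult)
    have le: "b j * min 1 (\<psi> (b j)) \<le> s ^ CARD('m) * (s ^ (j * CARD('n)) / s ^ (l j * CARD('m)))" for j
      using mult_left_mono[OF l(3)[of j], of "b j"] b[of j] by (simp add: b_def mult_ac)
    have sm': "summable (\<lambda>j. b j * min 1 (\<psi> (b j)))"
    proof (rule summable_comparison_test'[OF sm, of 0])
      fix j show "norm (b j * min 1 (\<psi> (b j))) \<le> s ^ CARD('m) * (s ^ (j * CARD('n)) / s ^ (l j * CARD('m)))"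
        using le[of j] b[of j] nonneg[of "b j"] by (simp add: abs_mult)
    qed
    \<comment> \<open>The cut-off preserves divergence: the terms of a convergent series tend to 0,
      and since b j >= 1 this forces \<psi> (b j) < 1 from some j on, where nothing is cut
      off.\<close>
    then have "(\<lambda>j. b j * min 1 (\<psi> (b j))) \<longlonglongrightarrow> 0" by (rule summable_LIMSEQ_zero)
    then have ev: "eventually (\<lambda>j. b j * min 1 (\<psi> (b j)) < 1) sequentially"
      by (rule order_tendstoD) simp
    have "\<forall>\<^sub>F j in sequentially. b j * min 1 (\<psi> (b j)) = b j * \<psi> (b j)"
      using ev
    proof (elim eventually_mono)
      fix j assume "b j * min 1 (\<psi> (b j)) < 1"
      then show "b j * min 1 (\<psi> (b j)) = b j * \<psi> (b j)"
        using b[of j] by (cases "\<psi> (b j) \<ge> 1") (auto simp: min_def)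
    qed
    from summable_cong[OF this] sm' have "summable (\<lambda>j. b j * \<psi> (b j))" by blast
    then show False using div sums_at_powers[OF nonneg noninc] by (simp add: b_def s_def)
  qed
  obtain S where S: "S \<in> events" "prob S \<ge> 1 / (1 + 16 * s ^ (2 * CARD('m)))"
    "\<And>A M. A \<in> S \<Longrightarrow> \<exists>j\<ge>M. \<exists>q\<in>denominators undefined j. \<exists>p. vec_to_k p + A *v vec_to_k q \<in> vball (int (l j))"
    using limsup_event_large[OF l(1) ns[unfolded s_def], where ?k0.0=undefined] unfolding s_def by blast
  have "S \<subseteq> W_set \<psi>"
    unfolding W_set_eq
  proof (intro subsetI CollectI conjI allI)
    fix A assume A: "A \<in> S"
    then show "A \<in> mball 0" using S(1) by (auto simp: sets_unit_ball)
    fix M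
    from S(3)[OF A, of M] obtain j q p where j: "j \<ge> M" and q: "q \<in> denominators undefined j"
      and p: "vec_to_k p + A *v vec_to_k q \<in> vball (int (l j))" by blast
    have deg: "q \<in> poly_vectors_degree j" using q by (rule denominators_degree)
    have "sup_norm (vec_to_k q) ^ CARD('n) = b j"
      by (simp add: sup_norm_poly_vector[OF deg] b_def s_def power_mult)
    then have "approximable \<psi> q A" using l(2)[of j] p unfolding approximable_def by auto
    moreover have "q \<notin> poly_vectors_below M"
      using deg j poly_vectors_below_mono[of q M j] by (auto simp: poly_vectors_degree_def)
    ultimately show "\<exists>q. q \<notin> poly_vectors_below M \<and> approximable \<psi> q A" by blast
  qed
  then have "prob S \<le> prob (W_set \<psi>)" by (intro finite_measure_mono W_set_events)
  then show ?thesis using S(2) by (simp add: lower_bound_def s_def)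
qed

section \<open>The convergence case\<close>

lemma prob_W_set_convergent:
  fixes \<psi> :: "real \<Rightarrow> real"
  assumes nonneg: "\<And>x. x > 0 \<Longrightarrow> \<psi> x \<ge> 0" and noninc: "antimono_on {0<..} \<psi>"
    and conv: "summable (\<lambda>x. \<psi> (real (Suc x)))"
  shows "prob (W_set \<psi>) = 0"
proof -
  define s where "s = real CARD('a)"
  have s: "s > 1" unfolding s_def by (rule card_gt_1)
  define b where "b = (\<lambda>j. s ^ (j * CARD('n)))"
  have b: "b j \<ge> 1" for j using s by (simp add: b_def)
  \<comment> \<open>Grouped by degree, at most s^((j+1)n) vectors with the same bound s^m
    \<psi>(s^(jn)) contribute, which reproduces the condensed series up to a constant.\<close>
  define G where "G = (\<lambda>j. \<Union>q\<in>(poly_vectors_degree j :: ('a poly ^ 'n) set).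
    {A :: 'a fls ^ 'n ^ 'm. A \<in> mball 0 \<and> approximable \<psi> q A})"
  have fin: "finite (poly_vectors_degree j :: ('a poly ^ 'n) set)" for j
    by (simp add: poly_vectors_degree_def)
  have ev: "{A \<in> mball 0. approximable \<psi> q A} \<in> events" for q
    by (intro event_sets stable_approximable)
  have G: "G j \<in> events" for j unfolding G_def by (intro sets.finite_UN fin ev)
  have bound: "prob (G j) \<le> (s ^ CARD('n) * s ^ CARD('m)) * (b j * \<psi> (b j))" for j
  proof -
    have "prob (G j) \<le> (\<Sum>q\<in>(poly_vectors_degree j :: ('a poly ^ 'n) set). prob {A \<in> mball 0. approximable \<psi> q A})"
      unfolding G_def using fin ev by (intro finite_measure_subadditive_finite) auto
    also have "\<dots> \<le> (\<Sum>q\<in>(poly_vectors_degree j :: ('a poly ^ 'n) set). s ^ CARD('m) * \<psi> (b j))"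
    proof (rule sum_mono)
      fix q :: "'a poly ^ 'n" assume q: "q \<in> poly_vectors_degree j"
      have "sup_norm (vec_to_k q) ^ CARD('n) = b j"
        by (simp add: sup_norm_poly_vector[OF q] b_def s_def power_mult)
      moreover have "q \<noteq> 0" using q by (auto simp: poly_vectors_degree_def poly_vectors_below_def)
      ultimately show "prob {A \<in> mball 0. approximable \<psi> q A} \<le> s ^ CARD('m) * \<psi> (b j)"
        using prob_approximable_le[of q \<psi>] nonneg[of "b j"] b[of j] by (simp add: s_def)
    qed
    also have "\<dots> = real (card (poly_vectors_degree j :: ('a poly ^ 'n) set)) * (s ^ CARD('m) * \<psi> (b j))" by simp
    also have "\<dots> \<le> s ^ (Suc j * CARD('n)) * (s ^ CARD('m) * \<psi> (b j))"
    proof (rule mult_right_mono)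
      have "card (poly_vectors_degree j :: ('a poly ^ 'n) set) \<le> card (poly_vectors_below (Suc j) :: ('a poly ^ 'n) set)"
        by (intro card_mono) (auto simp: poly_vectors_degree_def)
      then have "real (card (poly_vectors_degree j :: ('a poly ^ 'n) set)) \<le> real (CARD('a) ^ (Suc j * CARD('n)))"
        unfolding card_poly_vectors_below by (rule of_nat_mono)
      then show "real (card (poly_vectors_degree j :: ('a poly ^ 'n) set)) \<le> s ^ (Suc j * CARD('n))"
        by (simp add: s_def)
    qed (use s b[of j] nonneg[of "b j"] in auto)
    also have "\<dots> = (s ^ CARD('n) * s ^ CARD('m)) * (b j * \<psi> (b j))"
      by (simp add: b_def power_add)
    finally show ?thesis .
  qed
  have sm: "summable (\<lambda>j. (s ^ CARD('n) * s ^ CARD('m)) * (b j * \<psi> (b j)))"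
    using conv sums_at_powers[OF nonneg noninc] by (intro summable_mult) (simp add: b_def s_def)
  have "summable (\<lambda>j. prob (G j))"
    by (rule summable_comparison_test'[OF sm, of 0]) (use bound in auto)
  then have null: "limsup G \<in> null_sets unit_ball"
    using G by (intro borel_cantelli_limsup1) (auto simp: less_top[symmetric])
  have "W_set \<psi> \<subseteq> limsup G"
  proof
    fix A :: "'a fls ^ 'n ^ 'm" assume A: "A \<in> W_set \<psi>"
    have "\<exists>j\<ge>M. A \<in> G j" for M
    proof -
      obtain q where q: "q \<notin> poly_vectors_below M" "approximable \<psi> q A" using A unfolding W_set_eq by blast
      obtain j where "j \<ge> M" "q \<in> poly_vectors_degree j" using poly_vectors_degree_ex[OF q(1)] by blast
      then show ?thesis using q(2) A by (auto simp: G_def W_set_eq)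
    qed
    then show "A \<in> limsup G" by (auto simp: limsup_INF_SUP)
  qed
  then have "prob (W_set \<psi>) \<le> prob (limsup G)"
    using null by (intro finite_measure_mono) auto
  also have "\<dots> = 0" using null by (simp add: measure_def null_setsD1)
  finally show ?thesis by (simp add: measure_le_0_iff)
qed

section \<open>From the unit ball to small balls, and the divergence case\<close>

lemma prob_cell:
  assumes "C \<in> cells t"
  shows "prob {A \<in> mball 0. cell t C A} = prob (mball (int t))"
proof -
  have "prob {A \<in> mball 0. cell t C A} =
    prob {A \<in> mball 0. A - scale_X (1 - int t) (poly_matrix C) \<in> mball (int t)}"
    by (simp add: cell_def)
  also have "\<dots> = prob {A \<in> mball 0. A \<in> mball (int t)}"
    using cell_centre[OF assms] by (intro prob_translate stable_mball)
  also have "{A \<in> mball 0. A \<in> mball (int t)} = mball (int t)"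
    by (auto intro: mball_mono)
  finally show ?thesis .
qed

text \<open>The unit ball is a finite union of translates of this ball.\<close>

lemma prob_mball_pos: "prob (mball (int t)) > 0"
proof -
  have "prob {A \<in> mball 0. \<exists>C\<in>cells t. cell t C A} = real (card (cells t :: ('a poly ^ 'n ^ 'm) set)) * prob (mball (int t))"
    by (rule prob_equal_parts) (auto intro: stable_cell cell_unique prob_cell)
  moreover have "{A \<in> mball 0. \<exists>C\<in>cells t. cell t C A} = space unit_ball"
    using cell_exists by (auto simp: space_unit_ball)
  ultimately have "real (card (cells t :: ('a poly ^ 'n ^ 'm) set)) * prob (mball (int t)) = 1"
    by (simp add: prob_space)
  then have "prob (mball (int t)) \<noteq> 0" by auto
  then show ?thesis by (simp add: zero_less_measure_iff)
qed

text \<open>On the unit ball this is the restriction of \<mu> to the ball of radius s^-t, blown up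
  by X^t and normalised to total mass 1.\<close>

definition rescaled :: "nat \<Rightarrow> ('a fls ^ 'n ^ 'm) measure" where
  "rescaled t = scale_measure (inverse (emeasure \<mu> (mball (int t)))) (distr \<mu> borel (scale_X (int t)))"

lemma scale_X_measurable: "scale_X u \<in> measurable \<mu> borel"
  using scale_X_borel measurable_cong_sets[OF sets_eq refl] by blast

lemma emeasure_rescaled:
  assumes "E \<in> sets borel"
  shows "emeasure (rescaled t) E =
    inverse (emeasure \<mu> (mball (int t))) * emeasure \<mu> (scale_X (int t) -` E)"
  using assms by (simp add: rescaled_def emeasure_distr scale_X_measurable space_mu)

lemma scale_X_vimage_sets: "E \<in> sets borel \<Longrightarrow> scale_X u -` E \<in> sets borel"
  using measurable_sets[OF scale_X_borel, of E u] by simp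

lemma emeasure_mball: "emeasure \<mu> (mball (int t)) = ennreal (prob (mball (int t)))"
proof -
  have "mball (int t) \<subseteq> mball 0" by (auto intro: mball_mono)
  then show ?thesis by (metis emeasure_unit_ball emeasure_eq_measure)
qed

lemma haar_matrices_rescaled: "haar_matrices (rescaled t)"
proof
  show "sets (rescaled t) = sets borel" by (simp add: rescaled_def)
next
  fix E :: "('a fls ^ 'n ^ 'm) set" and B assume E: "E \<in> sets borel"
  have im: "scale_X (int t) -` ((\<lambda>A. B + A) ` E) = (\<lambda>A. scale_X (- int t) B + A) ` (scale_X (int t) -` E)"
  proof (intro equalityI subsetI)
    fix A assume "A \<in> scale_X (int t) -` ((\<lambda>A. B + A) ` E)"
    then obtain D where "scale_X (int t) A = B + D" "D \<in> E" by auto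
    then show "A \<in> (\<lambda>A. scale_X (- int t) B + A) ` (scale_X (int t) -` E)"
      by (intro image_eqI[of _ _ "A - scale_X (- int t) B"]) (auto simp: scale_X_diff scale_X_inverse)
  qed (auto simp: scale_X_add scale_X_inverse)
  have "(\<lambda>A. B + A) ` E = (\<lambda>A. - B + A) -` E"
  proof (intro equalityI subsetI)
    fix A assume "A \<in> (\<lambda>A. - B + A) -` E"
    then show "A \<in> (\<lambda>A. B + A) ` E" by (intro image_eqI[of _ _ "- B + A"]) auto
  qed auto
  moreover have "(\<lambda>A. - B + A) \<in> borel_measurable borel"
  proof (rule borel_measurableI)
    fix S :: "('a fls ^ 'n ^ 'm) set" assume S: "open S"
    have "open ((\<lambda>A. - B + A) -` S)"
      unfolding open_mball_iff
    proof
      fix A assume "A \<in> (\<lambda>A. - B + A) -` S"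
      then have "\<exists>u. \<forall>D\<in>mball u. (- B + A) + D \<in> S"
        using S unfolding open_mball_iff by blast
      then show "\<exists>u. \<forall>D\<in>mball u. A + D \<in> (\<lambda>A. - B + A) -` S"
        by (simp only: vimage_eq add.assoc)
    qed
    then show "(\<lambda>A. - B + A) -` S \<inter> space borel \<in> sets borel" by simp
  qed
  ultimately have "(\<lambda>A. B + A) ` E \<in> sets borel"
    using measurable_sets[of "\<lambda>A. - B + A" borel borel E] E by simp
  then show "emeasure (rescaled t) ((\<lambda>A. B + A) ` E) = emeasure (rescaled t) E"
    using E by (simp add: emeasure_rescaled im translate scale_X_vimage_sets)
next
  have "scale_X (int t) -` mball 0 = (mball (int t) :: ('a fls ^ 'n ^ 'm) set)"
    by (auto simp: scale_X_mball_iff)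
  then show "emeasure (rescaled t) (mball 0) = 1"
    using prob_mball_pos[of t]
    by (simp add: emeasure_rescaled mball_borel emeasure_mball inverse_ennreal flip: ennreal_mult)
qed

text \<open>The uniform lower bound is applied to the measure \<open>rescaled t\<close> and the
  function \<open>\<psi>'\<close>; \<open>W_set_scale\<close> places the shrunk and translated copy
  of \<open>W_set \<psi>'\<close> inside the part of \<open>W_set \<psi>\<close> in the
  cell.\<close>

lemma prob_W_set_cell:
  fixes \<psi> :: "real \<Rightarrow> real"
  assumes nonneg: "\<And>x. x > 0 \<Longrightarrow> \<psi> x \<ge> 0" and noninc: "antimono_on {0<..} \<psi>"
    and div: "\<not> summable (\<lambda>x. \<psi> (real (Suc x)))" and C: "C \<in> cells t"
  shows "prob ({A \<in> mball 0. cell t C A} \<inter> W_set \<psi>) \<ge>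
    lower_bound (real CARD('a)) CARD('m) * prob {A \<in> mball 0. cell t C A}"
proof -
  define c where "c = lower_bound (real CARD('a)) CARD('m)"
  define \<psi>' where "\<psi>' = (\<lambda>x. \<psi> (real CARD('a) ^ (t * CARD('n)) * x))"
  define R where "R = scale_X (1 - int t) (poly_matrix C)"
  define V where "V = scale_X (int t) -` (W_set \<psi>' :: ('a fls ^ 'n ^ 'm) set)"
  interpret r: haar_matrices "rescaled t" by (rule haar_matrices_rescaled)
  have s: "real CARD('a) > 1" by (rule card_gt_1)
  have c: "c \<ge> 0" by (simp add: c_def lower_bound_def)
  have nonneg': "\<psi>' x \<ge> 0" if "x > 0" for x
    unfolding \<psi>'_def using s that by (intro nonneg) simp
  have noninc': "antimono_on {0<..} \<psi>'"
    unfolding \<psi>'_def using s by (intro monotone_onI monotone_onD[OF noninc] mult_left_mono) auto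
  have pw: "real CARD('a) ^ ((j + t) * CARD('n)) =
      real CARD('a) ^ (t * CARD('n)) * real CARD('a) ^ (j * CARD('n))" for j
    by (simp add: add_mult_distrib power_add)
  \<comment> \<open>Up to the factor s^(tn), the condensed series of \<open>\<psi>'\<close> is that
    of \<psi> with its first t terms removed.\<close>
  have div': "\<not> summable (\<lambda>x. \<psi>' (real (Suc x)))"
  proof
    assume "summable (\<lambda>x. \<psi>' (real (Suc x)))"
    then have "summable (\<lambda>j. real CARD('a) ^ (j * CARD('n)) * \<psi>' (real CARD('a) ^ (j * CARD('n))))"
      using sums_at_powers[of \<psi>', OF nonneg' noninc'] by blast
    then have "summable (\<lambda>j. real CARD('a) ^ (t * CARD('n)) * (real CARD('a) ^ (j * CARD('n)) * \<psi>' (real CARD('a) ^ (j * CARD('n)))))"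
      by (rule summable_mult)
    also have "(\<lambda>j. real CARD('a) ^ (t * CARD('n)) * (real CARD('a) ^ (j * CARD('n)) * \<psi>' (real CARD('a) ^ (j * CARD('n))))) =
      (\<lambda>j. real CARD('a) ^ ((j + t) * CARD('n)) * \<psi> (real CARD('a) ^ ((j + t) * CARD('n))))"
      by (simp only: \<psi>'_def pw mult.assoc)
    finally have "summable (\<lambda>j. real CARD('a) ^ (j * CARD('n)) * \<psi> (real CARD('a) ^ (j * CARD('n))))"
      by (subst (asm) summable_iff_shift)
    then show False using div sums_at_powers[of \<psi>, OF nonneg noninc] by blast
  qed
  have W: "(W_set \<psi>' :: ('a fls ^ 'n ^ 'm) set) \<in> sets borel"
      "W_set \<psi>' \<subseteq> (mball 0 :: ('a fls ^ 'n ^ 'm) set)"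
    using r.W_set_events by (auto simp: r.sets_unit_ball)
  have V: "V \<in> sets borel" unfolding V_def by (intro scale_X_vimage_sets W)
  have Vsub: "V \<subseteq> mball (int t)"
    using W(2) by (auto simp: V_def subset_iff scale_X_mball_iff)
  have "ennreal c \<le> emeasure r.unit_ball (W_set \<psi>')"
    unfolding r.emeasure_eq_measure c_def
    using r.prob_W_set_lower_bound[OF nonneg' noninc' div'] by (intro ennreal_leI) simp
  also have "\<dots> = inverse (emeasure \<mu> (mball (int t))) * emeasure \<mu> V"
    using W by (simp add: r.emeasure_unit_ball emeasure_rescaled V_def)
  finally have "emeasure \<mu> (mball (int t)) * ennreal c \<le>
      emeasure \<mu> (mball (int t)) * (inverse (emeasure \<mu> (mball (int t))) * emeasure \<mu> V)"
    by (intro mult_left_mono) auto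
  also have "\<dots> = emeasure \<mu> V"
  proof -
    have "emeasure \<mu> (mball (int t)) * inverse (emeasure \<mu> (mball (int t))) = 1"
      using prob_mball_pos[of t] by (simp add: emeasure_mball inverse_ennreal flip: ennreal_mult)
    then show ?thesis by (simp add: mult.assoc[symmetric])
  qed
  also have "\<dots> = emeasure \<mu> ((\<lambda>A. R + A) ` V)" using V by (simp add: translate)
  also have "\<dots> \<le> emeasure \<mu> ({A \<in> mball 0. cell t C A} \<inter> W_set \<psi>)"
  proof (rule emeasure_mono)
    show "{A \<in> mball 0. cell t C A} \<inter> W_set \<psi> \<in> sets \<mu>"
      using sets.Int[OF event_sets[OF stable_cell] W_set_events[of \<psi>], of t C]
      by (simp add: sets_unit_ball sets_eq)
    show "(\<lambda>A. R + A) ` V \<subseteq> {A \<in> mball 0. cell t C A} \<inter> W_set \<psi>"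
    proof (rule image_subsetI)
      fix A assume A: "A \<in> V"
      have "scale_X (int t) A \<in> W_set \<psi>'" using A by (simp add: V_def)
      then have "R + scale_X (- int t) (scale_X (int t) A) \<in> W_set \<psi>"
        unfolding R_def \<psi>'_def by (rule W_set_scale[OF _ C])
      then have "R + A \<in> W_set \<psi>" by (simp add: scale_X_inverse')
      moreover have "cell t C (R + A)" using A Vsub by (auto simp: cell_def R_def)
      ultimately show "R + A \<in> {A \<in> mball 0. cell t C A} \<inter> W_set \<psi>" by (auto simp: W_set_eq)
    qed
  qed
  also have "\<dots> = ennreal (prob ({A \<in> mball 0. cell t C A} \<inter> W_set \<psi>))"
    by (subst emeasure_unit_ball[symmetric]) (auto simp: emeasure_eq_measure)
  finally have "ennreal (prob (mball (int t)) * c) \<le> ennreal (prob ({A \<in> mball 0. cell t C A} \<inter> W_set \<psi>))"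
    using c by (simp add: emeasure_mball ennreal_mult)
  then have "prob (mball (int t)) * c \<le> prob ({A \<in> mball 0. cell t C A} \<inter> W_set \<psi>)"
    by (simp add: ennreal_le_iff)
  then show ?thesis using prob_cell[OF C] by (simp add: c_def mult.commute)
qed

text \<open>At a depth t beyond which the condition no longer sees any digit, the event is a
  disjoint union of whole cells, and the cell estimates add up.\<close>

lemma prob_W_set_stable:
  fixes \<psi> :: "real \<Rightarrow> real"
  assumes nonneg: "\<And>x. x > 0 \<Longrightarrow> \<psi> x \<ge> 0" and noninc: "antimono_on {0<..} \<psi>"
    and div: "\<not> summable (\<lambda>x. \<psi> (real (Suc x)))" and P: "stable P"
  shows "prob ({A \<in> mball 0. P A} \<inter> W_set \<psi>) \<ge>
    lower_bound (real CARD('a)) CARD('m) * prob {A \<in> mball 0. P A}"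
proof -
  obtain u where u: "\<And>A B. B \<in> mball u \<Longrightarrow> P (A + B) \<longleftrightarrow> P A" using P unfolding stable_def by blast
  define t where "t = nat (max u 0)"
  have Pt: "P (A + B) \<longleftrightarrow> P A" if "B \<in> mball (int t)" for A B
    by (rule u) (rule mball_mono[OF that], simp add: t_def)
  define D where "D = {C \<in> cells t. P (scale_X (1 - int t) (poly_matrix C))}"
  define K where "K = (\<lambda>C. {A :: 'a fls ^ 'n ^ 'm. A \<in> mball 0 \<and> cell t C A})"
  have fin: "finite D" by (simp add: D_def)
  have K: "K C \<in> events" for C unfolding K_def by (intro event_sets stable_cell)
  have PK: "P A \<longleftrightarrow> P (scale_X (1 - int t) (poly_matrix C))" if "cell t C A" for A C
    using Pt[of "A - scale_X (1 - int t) (poly_matrix C)" "scale_X (1 - int t) (poly_matrix C)"] that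
    by (simp add: cell_def)
  have eq: "{A \<in> mball 0. P A} = (\<Union>C\<in>D. K C)"
    using cell_exists[where t=t] PK by (fastforce simp: D_def K_def)
  have disj: "disjoint_family_on K D"
    unfolding disjoint_family_on_def K_def using cell_unique by blast
  have disj': "disjoint_family_on (\<lambda>C. K C \<inter> W_set \<psi>) D"
    using disj unfolding disjoint_family_on_def by blast
  have "lower_bound (real CARD('a)) CARD('m) * prob {A \<in> mball 0. P A} =
      lower_bound (real CARD('a)) CARD('m) * (\<Sum>C\<in>D. prob (K C))"
    unfolding eq using fin K disj by (subst finite_measure_finite_Union) auto
  also have "\<dots> = (\<Sum>C\<in>D. lower_bound (real CARD('a)) CARD('m) * prob (K C))"
    by (rule sum_distrib_left)
  also have "\<dots> \<le> (\<Sum>C\<in>D. prob (K C \<inter> W_set \<psi>))"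
    unfolding K_def by (intro sum_mono prob_W_set_cell nonneg noninc div) (auto simp: D_def)
  also have "\<dots> = prob (\<Union>C\<in>D. K C \<inter> W_set \<psi>)"
    using fin K W_set_events disj' by (intro finite_measure_finite_Union[symmetric]) auto
  also have "(\<Union>C\<in>D. K C \<inter> W_set \<psi>) = {A \<in> mball 0. P A} \<inter> W_set \<psi>" unfolding eq by blast
  finally show ?thesis .
qed

lemma prob_W_set_divergent:
  fixes \<psi> :: "real \<Rightarrow> real"
  assumes nonneg: "\<And>x. x > 0 \<Longrightarrow> \<psi> x \<ge> 0" and noninc: "antimono_on {0<..} \<psi>"
    and div: "\<not> summable (\<lambda>x. \<psi> (real (Suc x)))"
  shows "prob (W_set \<psi>) = 1"
proof -
  define c where "c = lower_bound (real CARD('a)) CARD('m)"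
  have c: "c > 0" unfolding c_def lower_bound_def by (simp add: add_pos_pos)
  \<comment> \<open>No q with degree from M to L - 1 approximates A. Only finitely many q are
    involved, so the condition is stable; for fixed M these sets decrease in L.\<close>
  define D where "D = (\<lambda>M L. {A :: 'a fls ^ 'n ^ 'm. A \<in> mball 0 \<and>
    (\<forall>q\<in>poly_vectors_below L - poly_vectors_below M. \<not> approximable \<psi> q A)})"
  have st: "stable (\<lambda>A :: 'a fls ^ 'n ^ 'm. \<forall>q\<in>poly_vectors_below L - poly_vectors_below M. \<not> approximable \<psi> q A)" for L M
    by (intro stable_ball stable_not stable_approximable) auto
  have D: "D M L \<in> events" for M L unfolding D_def by (intro event_sets st)
  have DI: "(\<Inter>L. D M L) = {A \<in> mball 0. \<forall>q. q \<notin> poly_vectors_below M \<longrightarrow> \<not> approximable \<psi> q A}" for M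
    using poly_vector_below_ex by (fastforce simp: D_def)
  have null: "prob (\<Inter>L. D M L) = 0" for M
  proof -
    \<comment> \<open>The intersection is disjoint from the approximable set, which takes up at
      least the proportion c of each \<open>D M L\<close>. In the limit L to infinity both sides
      contain the measure of the intersection, which must then be 0.\<close>
    have le: "prob (\<Inter>L. D M L) \<le> (1 - c) * prob (D M L)" for L
    proof -
      have lower: "prob (D M L \<inter> W_set \<psi>) \<ge> c * prob (D M L)"
        unfolding c_def D_def by (intro prob_W_set_stable nonneg noninc div st)
      have "prob (\<Inter>L. D M L) \<le> prob (D M L - D M L \<inter> W_set \<psi>)"
      proof (rule finite_measure_mono)
        show "(\<Inter>L. D M L) \<subseteq> D M L - D M L \<inter> W_set \<psi>"
        proof
          fix A assume A: "A \<in> (\<Inter>L. D M L)"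
          then have "A \<notin> W_set \<psi>" unfolding DI W_set_eq by blast
          with A show "A \<in> D M L - D M L \<inter> W_set \<psi>" by blast
        qed
      qed (intro sets.Diff sets.Int D W_set_events)
      also have "\<dots> = prob (D M L) - prob (D M L \<inter> W_set \<psi>)"
        by (intro finite_measure_Diff D sets.Int W_set_events) auto
      finally show ?thesis using lower by (simp add: algebra_simps)
    qed
    have "poly_vectors_below L \<subseteq> (poly_vectors_below (Suc L) :: ('a poly ^ 'n) set)" for L
      using poly_vectors_below_mono[of _ L "Suc L"] by auto
    then have "decseq (D M)"
      unfolding D_def by (intro decseq_SucI) blast
    then have "(\<lambda>L. prob (D M L)) \<longlonglongrightarrow> prob (\<Inter>L. D M L)"
      using D by (intro finite_Lim_measure_decseq) auto
    then have "(\<lambda>L. (1 - c) * prob (D M L)) \<longlonglongrightarrow> (1 - c) * prob (\<Inter>L. D M L)"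
      by (intro tendsto_intros)
    then have "prob (\<Inter>L. D M L) \<le> (1 - c) * prob (\<Inter>L. D M L)"
      using le by (intro LIMSEQ_le_const) auto
    then have "c * prob (\<Inter>L. D M L) \<le> 0" by (simp add: algebra_simps)
    then show ?thesis using c by (simp add: mult_le_0_iff measure_le_0_iff)
  qed
  have "(\<Union>M. \<Inter>L. D M L) \<in> null_sets unit_ball"
  proof (rule null_sets_UN)
    fix M show "(\<Inter>L. D M L) \<in> null_sets unit_ball"
      using null[of M] D by (intro null_setsI) (auto simp: emeasure_eq_measure)
  qed
  moreover have "(\<Union>M. \<Inter>L. D M L) = space unit_ball - W_set \<psi>"
    unfolding DI space_unit_ball by (auto simp: W_set_eq)
  ultimately have "prob (space unit_ball - W_set \<psi>) = 0" by (simp add: measure_def null_setsD1)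
  then show ?thesis using prob_compl[OF W_set_events] by simp
qed

end

theorem theorem5p1:
  fixes \<psi> :: "real \<Rightarrow> real"
    and \<mu> :: "('a::{field,finite} fls ^ 'n ^ 'm) measure"
  assumes haar: "haar_measure \<mu>"
    and normalized: "emeasure \<mu> unit_matrices = 1"
    and nonneg: "\<And>x. x > 0 \<Longrightarrow> \<psi> x \<ge> 0"
    and noninc: "antimono_on {0<..} \<psi>"
    and cont: "continuous_on {0<..} \<psi>"
  shows "(W_set \<psi> :: ('a fls ^ 'n ^ 'm) set) \<in> sets \<mu> \<and>
    emeasure \<mu> (W_set \<psi> :: ('a fls ^ 'n ^ 'm) set) =
      (if summable (\<lambda>x::nat. \<psi> (real (Suc x))) then 0 else 1)"
proof -
  interpret haar_matrices \<mu>
    using haar normalized by unfold_locales (auto simp: haar_measure_def mball_0_eq)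
  have W: "W_set \<psi> \<in> sets \<mu>" "W_set \<psi> \<subseteq> (mball 0 :: ('a fls ^ 'n ^ 'm) set)"
    using W_set_events[of \<psi>] by (auto simp: sets_unit_ball sets_eq)
  have "emeasure \<mu> (W_set \<psi>) = ennreal (prob (W_set \<psi>))"
    using emeasure_unit_ball[OF W(2)] by (simp add: emeasure_eq_measure)
  with W(1) show ?thesis
    using prob_W_set_convergent[OF nonneg noninc] prob_W_set_divergent[OF nonneg noninc] by simp
qed

end
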